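(* Let $F=\sum_{1\le t\le N}F_t$ be a holomorphic correspondence on the Riemann sphere $\widehat{\mathbb{C}}$ and let $g\in\mathcal{C}(\widehat{\mathbb{C}},\mathbb{R})$. Then the topological pressure $\mathrm{Pr}(g,F)$ of $g$ with respect to $F$ satisfies $$\mathrm{Pr}(g,F)=\lim_{\delta\to 0}\ \sup_{\mathcal{U}}\ \lim_{k\to\infty}\frac{1}{k}\log\mathcal{N}_k^F(g,\mathcal{U})=\lim_{\delta\to 0}\ \sup_{\mathcal{U}}\ \lim_{k\to\infty}\frac{1}{k}\log\mathcal{M}_k^F(g,\mathcal{U}),$$ where the suprema are taken over all open covers $\mathcal{U}$ of $\widehat{\mathbb{C}}$ with $\mathrm{diam}(\mathcal{U})<\delta$.
   Context: Holomorphic correspondence: a formal sum $F=\sum_{1\le t\le N}F_t$, where the $F_t$ are irreducible complex-analytic subvarieties (repeated according to multiplicity) of pure dimension $1$ in $\widehat{\mathbb{C}}\times\widehat{\mathbb{C}}$ such that, with $\pi_1,\pi_2$ the two coordinate projections, (1) $\pi_1|_{F_t}$ and $\pi_2|_{F_t}$ are surjective for each $t$; (2) for all $x,y\in\widehat{\mathbb{C}}$ and all $t$, the sets $\pi_2(\pi_1^{-1}(\{x\})\cap F_t)$ and $\pi_1(\pi_2^{-1}(\{y\})\cap F_t)$ are finite. Orbits: for $k\ge 1$, $\mathcal{P}_k^F(\widehat{\mathbb{C}})$ is the set of all permissible forward orbits of length $k$, i.e. all tuples $\mathbf{X}=(z_0,z_1,\dots,z_k;\alpha_1,\dots,\alpha_k)$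 with $z_i\in\widehat{\mathbb{C}}$, $\alpha_r\in\{1,\dots,N\}$ and $(z_{r-1},z_r)\in F_{\alpha_r}$ for $1\le r\le k$. Put $\Pi_i(\mathbf{X})=z_i$ for $0\le i\le k$ and $\mathrm{proj}_i(\mathbf{X})=\alpha_i$ for $1\le i\le k$. Let $d_{\widehat{\mathbb{C}}}$ be the spherical metric. For $g\in\mathcal{C}(\widehat{\mathbb{C}},\mathbb{R})$ write $E_k(g,\mathbf{X})=\exp\left(\sum_{i=0}^{k-1}g(\Pi_i(\mathbf{X}))\right)$. Spanning sets: $\mathcal{V}\subseteq\mathcal{P}_k^F(\widehat{\mathbb{C}})$ is $(k,\epsilon)$-spanning if for every $\mathbf{X}\in\mathcal{P}_k^F(\widehat{\mathbb{C}})$ there is $\mathbf{Y}\in\mathcal{V}$ with the same word ($\mathrm{proj}_i(\mathbf{Y})=\mathrm{proj}_i(\mathbf{X})$ for $1\le i\le k$) and $d_{\widehat{\mathbb{C}}}(\Pi_i(\mathbf{X}),\Pi_i(\mathbf{Y}))<\epsilon$ for all $0\le i\le k$. Separated sets: $\mathcal{Y}\subseteq\mathcal{P}_k^F(\widehat{\mathbb{C}})$ is $(k,\epsilon)$-separated if for every pair of distinct $\mathbf{X},\mathbf{Y}\in\mathcal{Y}$, either $d_{\widehat{\mathbb{C}}}(\Pi_i(\mathbf{X}),\Pi_i(\mathbf{Y}))>\epsilon$ for some $0\le i\le k$, or $\mathrm{proj}_i(\mathbf{X})\ne\mathrm{proj}_i(\mathbf{Y})$ for some $1\le i\le k$. $$\mathscr{R}_k^F(g,\epsilon)=\inf\Big\{\sum_{\mathbf{X}\in\mathcal{V}}E_k(g,\mathbf{X}):\mathcal{V}\text{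 is }(k,\epsilon)\text{-spanning}\Big\},\qquad \mathscr{S}_k^F(g,\epsilon)=\sup\Big\{\sum_{\mathbf{X}\in\mathcal{Y}}E_k(g,\mathbf{X}):\mathcal{Y}\text{ is }(k,\epsilon)\text{-separated}\Big\}.$$ Topological pressure (the two expressions are known to agree): $$\mathrm{Pr}(g,F)=\lim_{\epsilon\to 0}\limsup_{k\to\infty}\frac{1}{k}\log\mathscr{S}_k^F(g,\epsilon)=\lim_{\epsilon\to 0}\limsup_{k\to\infty}\frac{1}{k}\log\mathscr{R}_k^F(g,\epsilon).$$ Open covers: for an open cover $\mathcal{U}$ of $\widehat{\mathbb{C}}$, let $\mathcal{U}_k^F=\bigvee_{i=0}^{k-1}\{\Pi_i^{-1}(\mathcal{U})\cap\mathrm{proj}_{i+1}^{-1}\{j\}:1\le j\le N\}\bigvee\Pi_k^{-1}(\mathcal{U})$, i.e. the open cover of $\mathcal{P}_k^F(\widehat{\mathbb{C}})$ by all sets $\bigcap_{i=0}^{k}\Pi_i^{-1}(U_i)\cap\bigcap_{i=1}^{k}\mathrm{proj}_i^{-1}\{j_i\}$ with $U_i\in\mathcal{U}$, $j_i\in\{1,\dots,N\}$ (empty members of a subcover may be discarded). Define $$\mathcal{M}_k^F(g,\mathcal{U})=\inf_{\mathcal{C}}\sum_{\gamma\in\mathcal{C}}\inf_{\mathbf{X}\in\gamma}E_k(g,\mathbf{X}),\qquad \mathcal{N}_k^F(g,\mathcal{U})=\inf_{\mathcal{C}}\sum_{\gamma\in\mathcal{C}}\sup_{\mathbf{X}\in\gamma}E_k(g,\mathbf{X}),$$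 where $\mathcal{C}$ ranges over finite subcovers of $\mathcal{U}_k^F$. $\mathrm{diam}(\mathcal{U})=\sup_{U\in\mathcal{U}}\mathrm{diam}(U)$ with respect to $d_{\widehat{\mathbb{C}}}$.
   Formalization: The limit over k in the M-expression need not exist for a given cover (it can fail for covers of arbitrarily small diameter), so the M-formula is stated with liminf and also with limsup over k in place of lim; the limit in the N-expression is proved to exist. *)

theory Defs
  imports "HOL-Analysis.Analysis"
begin

subsection \<open>The Riemann sphere with its spherical metric\<close>

datatype riemann_sphere = Fin complex | Infty

text \<open>Inverse stereographic projection onto the unit sphere of \<open>\<complex> \<times> \<real>\<close>.\<close>

fun stereo :: "riemann_sphere \<Rightarrow> complex \<times> real" where
  "stereo (Fin z) = ((2 / (1 + (norm z)\<^sup>2)) *\<^sub>R z, ((norm z)\<^sup>2 - 1) / (1 + (norm z)\<^sup>2))"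
| "stereo Infty = (0, 1)"

lemma norm_stereo: "norm (stereo x) = 1"
proof (cases x)
  case (Fin z)
  have p: "1 + (norm z)\<^sup>2 > 0"
    by (simp add: add_pos_nonneg)
  have "stereo x \<bullet> stereo x = ((2 * norm z)\<^sup>2 + ((norm z)\<^sup>2 - 1)\<^sup>2) / (1 + (norm z)\<^sup>2)\<^sup>2"
    using p by (simp add: Fin inner_prod_def power2_norm_eq_inner[symmetric] power_mult_distrib
        power_divide add_divide_distrib) (simp add: power2_eq_square)
  also have "(2 * norm z)\<^sup>2 + ((norm z)\<^sup>2 - 1)\<^sup>2 = (1 + (norm z)\<^sup>2)\<^sup>2"
    by algebra
  also have "(1 + (norm z)\<^sup>2)\<^sup>2 / (1 + (norm z)\<^sup>2)\<^sup>2 = 1"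
    using p by simp
  finally show ?thesis
    by (simp add: norm_eq_sqrt_inner)
qed (simp add: norm_prod_def)

lemma inj_stereo: "inj stereo"
proof (rule injI)
  fix x y assume eq: "stereo x = stereo y"
  have ne: "snd (stereo (Fin z)) \<noteq> 1" for z
  proof -
    have "1 + (norm z)\<^sup>2 > 0"
      by (simp add: add_pos_nonneg)
    then show ?thesis
      by (simp add: field_simps)
  qed
  have rec: "z = (1 / (1 - snd (stereo (Fin z)))) *\<^sub>R fst (stereo (Fin z))" for z
  proof -
    have p: "1 + (norm z)\<^sup>2 > 0"
      by (simp add: add_pos_nonneg)
    then have "1 - snd (stereo (Fin z)) = 2 / (1 + (norm z)\<^sup>2)"
      by (simp add: field_simps)
    moreover have "(1 / (2 / (1 + (norm z)\<^sup>2))) * (2 / (1 + (norm z)\<^sup>2)) = 1"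
      using p by simp
    ultimately show ?thesis
      by (simp only: stereo.simps fst_conv scaleR_scaleR scaleR_one)
  qed
  show "x = y"
  proof (cases x; cases y)
    fix z w assume xy: "x = Fin z" "y = Fin w"
    show ?thesis
      using rec[of z] rec[of w] eq unfolding xy by metis
  next
    fix z assume "x = Fin z" "y = Infty"
    then show ?thesis using ne[of z] eq by simp
  next
    fix z assume "x = Infty" "y = Fin z"
    then show ?thesis using ne[of z] eq by (metis snd_conv stereo.simps(2))
  qed auto
qed

lemma arccos_inner_triangle:
  fixes x y z :: "'a::real_inner"
  assumes "norm x = 1" "norm y = 1" "norm z = 1"
  shows "arccos (x \<bullet> z) \<le> arccos (x \<bullet> y) + arccos (y \<bullet> z)"
proof -
  have b: "-1 \<le> u \<bullet> v \<and> u \<bullet> v \<le> 1" if "norm u = 1" "norm v = 1" for u v :: 'a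
    using Cauchy_Schwarz_ineq2[of u v] that by auto
  note bxy = b[OF assms(1,2)] and byz = b[OF assms(2,3)] and bxz = b[OF assms(1,3)]
  let ?a = "arccos (x \<bullet> y)" and ?b = "arccos (y \<bullet> z)"
  have ab: "0 \<le> ?a" "0 \<le> ?b"
    using bxy byz by (auto intro: arccos_lbound)
  show ?thesis
  proof (cases "?a + ?b \<le> pi")
    case False
    then show ?thesis
      using arccos_ubound[of "x \<bullet> z"] bxz by linarith
  next
    case True
    have i1: "u \<bullet> u = 1" if "norm u = 1" for u :: 'a
      using that by (simp add: norm_eq_1)
    have "(norm (x - (x \<bullet> y) *\<^sub>R y))\<^sup>2 = 1 - (x \<bullet> y)\<^sup>2"
      unfolding power2_norm_eq_inner using i1 assms
      by (simp add: inner_diff_left inner_diff_right inner_commute power2_eq_square)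
    then have n1: "norm (x - (x \<bullet> y) *\<^sub>R y) = sin ?a"
      using bxy by (simp add: sin_arccos real_sqrt_unique)
    have "(norm (z - (y \<bullet> z) *\<^sub>R y))\<^sup>2 = 1 - (y \<bullet> z)\<^sup>2"
      unfolding power2_norm_eq_inner using i1 assms
      by (simp add: inner_diff_left inner_diff_right inner_commute power2_eq_square)
    then have n2: "norm (z - (y \<bullet> z) *\<^sub>R y) = sin ?b"
      using byz by (simp add: sin_arccos real_sqrt_unique)
    have "(x - (x \<bullet> y) *\<^sub>R y) \<bullet> (z - (y \<bullet> z) *\<^sub>R y) = x \<bullet> z - (x \<bullet> y) * (y \<bullet> z)"
      using i1 assms by (simp add: inner_diff_left inner_diff_right inner_commute)
    then have "x \<bullet> z - (x \<bullet> y) * (y \<bullet> z) \<ge> - (sin ?a * sin ?b)"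
      using Cauchy_Schwarz_ineq2[of "x - (x \<bullet> y) *\<^sub>R y" "z - (y \<bullet> z) *\<^sub>R y"] n1 n2 by (simp add: abs_le_iff)
    then have "cos (?a + ?b) \<le> x \<bullet> z"
      using bxy byz by (simp add: cos_add)
    then have "arccos (x \<bullet> z) \<le> arccos (cos (?a + ?b))"
      using bxz by (intro arccos_le_arccos) auto
    also have "\<dots> = ?a + ?b"
      using ab True by (intro arccos_cos) auto
    finally show ?thesis .
  qed
qed

text \<open>
  The spherical metric is the great-circle distance on the unit sphere; its length element is
  \<open>2 |dz| / (1 + |z|\<^sup>2)\<close>.
\<close>

instantiation riemann_sphere :: metric_space
begin

definition dist_riemann_sphere :: "riemann_sphere \<Rightarrow> riemann_sphere \<Rightarrow> real" where
  "dist_riemann_sphere x y = arccos (stereo x \<bullet> stereo y)"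

definition uniformity_riemann_sphere :: "(riemann_sphere \<times> riemann_sphere) filter" where
  "uniformity_riemann_sphere = (INF e\<in>{0<..}. principal {(x, y). dist x y < e})"

definition open_riemann_sphere :: "riemann_sphere set \<Rightarrow> bool" where
  "open_riemann_sphere U \<longleftrightarrow> (\<forall>x\<in>U. eventually (\<lambda>(x', y). x' = x \<longrightarrow> y \<in> U) uniformity)"

instance
proof
  fix x y z :: riemann_sphere
  have b: "\<bar>stereo x \<bullet> stereo y\<bar> \<le> 1"
    using Cauchy_Schwarz_ineq2[of "stereo x" "stereo y"] by (simp add: norm_stereo)
  have "arccos (stereo x \<bullet> stereo y) = 0 \<longleftrightarrow> stereo x \<bullet> stereo y = 1"
    using b by (metis abs_le_iff arccos_1 cos_arccos cos_zero minus_le_iff)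
  also have "\<dots> \<longleftrightarrow> (norm (stereo x - stereo y))\<^sup>2 = 0"
    unfolding power2_norm_eq_inner
    using norm_stereo[of x] norm_stereo[of y]
    by (simp add: inner_diff_left inner_diff_right inner_commute norm_eq_1)
  also have "\<dots> \<longleftrightarrow> x = y"
    using inj_stereo by (auto dest: injD)
  finally show "dist x y = 0 \<longleftrightarrow> x = y"
    by (simp add: dist_riemann_sphere_def)
  show "dist x y \<le> dist x z + dist y z"
    using arccos_inner_triangle[of "stereo x" "stereo z" "stereo y"]
    by (simp add: dist_riemann_sphere_def norm_stereo inner_commute)
qed (rule uniformity_riemann_sphere_def open_riemann_sphere_def)+

end


subsection \<open>Analytic subvarieties of the product of two Riemann spheres\<close>

definition holomorphic2_on :: "(complex \<times> complex \<Rightarrow> complex) \<Rightarrow> (complex \<times> complex) set \<Rightarrow> bool" where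
  "holomorphic2_on f S \<longleftrightarrow>
     (\<forall>p\<in>S. \<exists>a b. (f has_derivative (\<lambda>(u, v). a * u + b * v)) (at p))"

text \<open>The inverses of the two standard charts, \<open>z\<close> and \<open>1/z\<close>, of the Riemann sphere.\<close>

fun sphere_param :: "bool \<Rightarrow> complex \<Rightarrow> riemann_sphere" where
  "sphere_param False z = Fin z"
| "sphere_param True z = (if z = 0 then Infty else Fin (inverse z))"

definition sphere_param2 ::
  "bool \<Rightarrow> bool \<Rightarrow> complex \<times> complex \<Rightarrow> riemann_sphere \<times> riemann_sphere" where
  "sphere_param2 i j = map_prod (sphere_param i) (sphere_param j)"

definition sphere_holomorphic2_on ::
  "(riemann_sphere \<times> riemann_sphere \<Rightarrow> complex) \<Rightarrow> (riemann_sphere \<times> riemann_sphere) set \<Rightarrow> bool" where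
  "sphere_holomorphic2_on f W \<longleftrightarrow>
     (\<forall>i j. holomorphic2_on (f \<circ> sphere_param2 i j) (sphere_param2 i j -` W))"

definition analytic_subvariety :: "(riemann_sphere \<times> riemann_sphere) set \<Rightarrow> bool" where
  "analytic_subvariety A \<longleftrightarrow>
     (\<forall>p. \<exists>W H. open W \<and> p \<in> W \<and> finite H \<and> (\<forall>h\<in>H. sphere_holomorphic2_on h W) \<and>
        A \<inter> W = {q \<in> W. \<forall>h\<in>H. h q = 0})"

definition irreducible_subvariety :: "(riemann_sphere \<times> riemann_sphere) set \<Rightarrow> bool" where
  "irreducible_subvariety A \<longleftrightarrow> analytic_subvariety A \<and> A \<noteq> {} \<and>
     (\<forall>B C. analytic_subvariety B \<and> analytic_subvariety C \<and> A = B \<union> C \<longrightarrow> A = B \<or> A = C)"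

definition coord_subspace :: "nat \<Rightarrow> (complex \<times> complex) set" where
  "coord_subspace d = {(u, v). (d < 1 \<longrightarrow> u = 0) \<and> (d < 2 \<longrightarrow> v = 0)}"

text \<open>
  Near \<open>p\<close>, the set \<open>A\<close> is a complex submanifold of dimension \<open>d\<close>: some biholomorphic
  map \<open>\<phi>\<close> (with inverse \<open>\<psi>\<close>) straightens it to a coordinate subspace.
\<close>

definition submanifold_at :: "(complex \<times> complex) set \<Rightarrow> nat \<Rightarrow> complex \<times> complex \<Rightarrow> bool" where
  "submanifold_at A d p \<longleftrightarrow>
     (\<exists>U \<phi> \<psi>. open U \<and> p \<in> U \<and> open (\<phi> ` U) \<and>
        holomorphic2_on (fst \<circ> \<phi>) U \<and> holomorphic2_on (snd \<circ> \<phi>) U \<and>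
        holomorphic2_on (fst \<circ> \<psi>) (\<phi> ` U) \<and> holomorphic2_on (snd \<circ> \<psi>) (\<phi> ` U) \<and>
        (\<forall>q\<in>U. \<psi> (\<phi> q) = q) \<and> \<phi> ` (A \<inter> U) = \<phi> ` U \<inter> coord_subspace d)"

definition regular_points ::
  "(riemann_sphere \<times> riemann_sphere) set \<Rightarrow> nat \<Rightarrow> (riemann_sphere \<times> riemann_sphere) set" where
  "regular_points A d =
     {p \<in> A. \<exists>i j q. p = sphere_param2 i j q \<and> submanifold_at (sphere_param2 i j -` A) d q}"

text \<open>
  The dimension of a subvariety at \<open>p\<close> is the largest dimension of the manifold of regular points
  arbitrarily close to \<open>p\<close>; regular points are dense, so the maximum is over a nonempty set when
  \<open>p\<close> lies on the subvariety.
\<close>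

definition local_dim :: "(riemann_sphere \<times> riemann_sphere) set \<Rightarrow> riemann_sphere \<times> riemann_sphere \<Rightarrow> nat" where
  "local_dim A p = Max {d. d \<le> 2 \<and> p \<in> closure (regular_points A d)}"

definition pure_dimension :: "(riemann_sphere \<times> riemann_sphere) set \<Rightarrow> nat \<Rightarrow> bool" where
  "pure_dimension A n \<longleftrightarrow> (\<forall>p\<in>A. local_dim A p = n)"


subsection \<open>Holomorphic correspondences and their orbits\<close>

text \<open>
  The formal sum \<open>F\<^sub>1 + \<dots> + F\<^sub>N\<close> is given by \<open>N\<close> and the family \<open>F\<close>, of which only the values at
  \<open>1, \<dots>, N\<close> matter; repetitions are allowed.
\<close>

definition holomorphic_correspondence ::
  "nat \<Rightarrow> (nat \<Rightarrow> (riemann_sphere \<times> riemann_sphere) set) \<Rightarrow> bool" where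
  "holomorphic_correspondence N F \<longleftrightarrow> 1 \<le> N \<and>
     (\<forall>t\<in>{1..N}. irreducible_subvariety (F t) \<and> pure_dimension (F t) 1 \<and>
        fst ` F t = UNIV \<and> snd ` F t = UNIV \<and>
        (\<forall>x. finite (snd ` (fst -` {x} \<inter> F t))) \<and>
        (\<forall>y. finite (fst ` (snd -` {y} \<inter> F t))))"

text \<open>The orbit \<open>(z\<^sub>0, \<dots>, z\<^sub>k; \<alpha>\<^sub>1, \<dots>, \<alpha>\<^sub>k)\<close> is a pair of lists of lengths \<open>k + 1\<close> and \<open>k\<close>.\<close>

type_synonym orbit = "riemann_sphere list \<times> nat list"

definition Pi_coord :: "nat \<Rightarrow> orbit \<Rightarrow> riemann_sphere" where
  "Pi_coord i X = fst X ! i"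

definition proj_coord :: "nat \<Rightarrow> orbit \<Rightarrow> nat" where
  "proj_coord i X = snd X ! (i - 1)"

definition orbits ::
  "nat \<Rightarrow> (nat \<Rightarrow> (riemann_sphere \<times> riemann_sphere) set) \<Rightarrow> nat \<Rightarrow> orbit set" where
  "orbits N F k = {X. length (fst X) = k + 1 \<and> length (snd X) = k \<and>
     (\<forall>r\<in>{1..k}. proj_coord r X \<in> {1..N} \<and>
        (Pi_coord (r - 1) X, Pi_coord r X) \<in> F (proj_coord r X))}"

definition E_weight :: "nat \<Rightarrow> (riemann_sphere \<Rightarrow> real) \<Rightarrow> orbit \<Rightarrow> real" where
  "E_weight k g X = exp (\<Sum>i<k. g (Pi_coord i X))"


subsection \<open>Topological pressure\<close>

definition separated ::
  "nat \<Rightarrow> (nat \<Rightarrow> (riemann_sphere \<times> riemann_sphere) set) \<Rightarrow> nat \<Rightarrow> real \<Rightarrow> orbit set \<Rightarrow> bool" where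
  "separated N F k \<epsilon> Y \<longleftrightarrow> Y \<subseteq> orbits N F k \<and>
     (\<forall>X\<in>Y. \<forall>X'\<in>Y. X \<noteq> X' \<longrightarrow>
        (\<exists>i\<le>k. dist (Pi_coord i X) (Pi_coord i X') > \<epsilon>) \<or>
        (\<exists>i\<in>{1..k}. proj_coord i X \<noteq> proj_coord i X'))"

definition separated_sum ::
  "nat \<Rightarrow> (nat \<Rightarrow> (riemann_sphere \<times> riemann_sphere) set) \<Rightarrow> nat \<Rightarrow> (riemann_sphere \<Rightarrow> real) \<Rightarrow> real \<Rightarrow> ennreal"
where
  "separated_sum N F k g \<epsilon> =
     (SUP Y\<in>{Y. separated N F k \<epsilon> Y}. \<Sum>\<^sub>\<infinity>X\<in>Y. ennreal (E_weight k g X))"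

definition ennreal_ln :: "ennreal \<Rightarrow> ereal" where
  "ennreal_ln x = (if x = 0 then -\<infinity> else if x = \<infinity> then \<infinity> else ereal (ln (enn2real x)))"

definition pressure ::
  "nat \<Rightarrow> (nat \<Rightarrow> (riemann_sphere \<times> riemann_sphere) set) \<Rightarrow> (riemann_sphere \<Rightarrow> real) \<Rightarrow> ereal" where
  "pressure N F g =
     Lim (at_right 0) (\<lambda>\<epsilon>. limsup (\<lambda>k. ereal (1 / real k) * ennreal_ln (separated_sum N F k g \<epsilon>)))"

text \<open>The outer limit always exists, by monotonicity in \<open>\<epsilon>\<close>.\<close>

lemma separated_sum_antimono:
  assumes "\<epsilon> \<le> \<epsilon>'"
  shows "separated_sum N F k g \<epsilon>' \<le> separated_sum N F k g \<epsilon>"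
  unfolding separated_sum_def
  by (rule SUP_subset_mono) (use assms in \<open>force simp: separated_def\<close>)+

lemma ennreal_ln_mono:
  assumes "x \<le> y"
  shows "ennreal_ln x \<le> ennreal_ln y"
proof (cases "x = 0 \<or> y = \<infinity>")
  case False
  then have "enn2real x > 0" "enn2real x \<le> enn2real y" "x \<noteq> \<infinity>" "y \<noteq> 0"
    using assms by (auto simp: enn2real_positive_iff less_top top_unique zero_less_iff_neq_zero
        intro!: enn2real_mono)
  with False show ?thesis
    by (auto simp: ennreal_ln_def)
qed (use assms in \<open>auto simp: ennreal_ln_def top_unique\<close>)

lemma pressure_tendsto:
  "((\<lambda>\<epsilon>. limsup (\<lambda>k. ereal (1 / real k) * ennreal_ln (separated_sum N F k g \<epsilon>)))
     \<longlongrightarrow> pressure N F g) (at_right 0)"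
proof -
  define f where
    "f = (\<lambda>\<epsilon>. limsup (\<lambda>k. ereal (1 / real k) * ennreal_ln (separated_sum N F k g \<epsilon>)))"
  have anti: "f b \<le> f a" if "a \<le> b" for a b
    unfolding f_def
    by (intro Limsup_mono always_eventually allI ereal_mult_left_mono ennreal_ln_mono
        separated_sum_antimono that) simp
  have "(f \<longlongrightarrow> (SUP a\<in>{0<..}. f a)) (at_right 0)"
  proof (rule order_tendstoI)
    fix l assume "l < (SUP a\<in>{0<..}. f a)"
    then obtain a where "a > 0" "l < f a"
      by (auto simp: less_SUP_iff)
    then show "eventually (\<lambda>x. l < f x) (at_right 0)"
      unfolding eventually_at_right_field
      by (intro exI[of _ a]) (use anti in \<open>meson less_imp_le less_le_trans\<close>)
  next
    fix l assume l: "(SUP a\<in>{0<..}. f a) < l"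
    have "f x < l" if "x > 0" for x
      using l that by (meson SUP_upper greaterThan_iff le_less_trans)
    then show "eventually (\<lambda>x. f x < l) (at_right 0)"
      unfolding eventually_at_right_field by (intro exI[of _ 1]) auto
  qed
  moreover from this have "pressure N F g = (SUP a\<in>{0<..}. f a)"
    unfolding pressure_def f_def by (intro tendsto_Lim) auto
  ultimately show ?thesis
    unfolding f_def by simp
qed


subsection \<open>Open covers\<close>

definition open_cover :: "riemann_sphere set set \<Rightarrow> bool" where
  "open_cover \<U> \<longleftrightarrow> (\<forall>U\<in>\<U>. open U) \<and> \<Union>\<U> = UNIV"

definition cover_diam :: "riemann_sphere set set \<Rightarrow> real" where
  "cover_diam \<U> = (SUP U\<in>\<U>. diameter U)"

definition orbit_cover ::
  "nat \<Rightarrow> (nat \<Rightarrow> (riemann_sphere \<times> riemann_sphere) set) \<Rightarrow> nat \<Rightarrow> riemann_sphere set set \<Rightarrow> orbit set set"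
where
  "orbit_cover N F k \<U> =
     {{X \<in> orbits N F k. (\<forall>i\<le>k. Pi_coord i X \<in> U i) \<and> (\<forall>i\<in>{1..k}. proj_coord i X = j i)} | U j.
        (\<forall>i\<le>k. U i \<in> \<U>) \<and> (\<forall>i\<in>{1..k}. j i \<in> {1..N})}"

definition finite_subcovers ::
  "nat \<Rightarrow> (nat \<Rightarrow> (riemann_sphere \<times> riemann_sphere) set) \<Rightarrow> nat \<Rightarrow> riemann_sphere set set \<Rightarrow> orbit set set set"
where
  "finite_subcovers N F k \<U> = {C. finite C \<and> C \<subseteq> orbit_cover N F k \<U> \<and> \<Union>C = orbits N F k}"

text \<open>
  In \<^typ>\<open>ennreal\<close> an empty \<open>\<gamma>\<close> has supremum \<open>0\<close> and infimum \<open>\<infinity>\<close>; discarding it from a subcover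
  leaves a subcover, so empty members do not affect either of the following infima.
\<close>

definition M_cover ::
  "nat \<Rightarrow> (nat \<Rightarrow> (riemann_sphere \<times> riemann_sphere) set) \<Rightarrow> nat \<Rightarrow> (riemann_sphere \<Rightarrow> real) \<Rightarrow> riemann_sphere set set \<Rightarrow> ennreal"
where
  "M_cover N F k g \<U> =
     (INF C\<in>finite_subcovers N F k \<U>. \<Sum>\<gamma>\<in>C. INF X\<in>\<gamma>. ennreal (E_weight k g X))"

definition N_cover ::
  "nat \<Rightarrow> (nat \<Rightarrow> (riemann_sphere \<times> riemann_sphere) set) \<Rightarrow> nat \<Rightarrow> (riemann_sphere \<Rightarrow> real) \<Rightarrow> riemann_sphere set set \<Rightarrow> ennreal"
where
  "N_cover N F k g \<U> =
     (INF C\<in>finite_subcovers N F k \<U>. \<Sum>\<gamma>\<in>C. SUP X\<in>\<gamma>. ennreal (E_weight k g X))"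

end

theory Submission
  imports Defs
begin

text \<open>
  The cover sums and the separated sums are compared in both directions at every length \<open>k\<close>.

  An orbit of a separated set is determined by the member of a subcover that contains it, as
  soon as the members are too small to hold two separated orbits. Hence the separated sum at
  scale \<open>\<delta>\<close> is at most \<^const>\<open>N_cover\<close> of any cover of diameter at most \<open>\<delta>\<close>
  (\<open>separated_sum_le_N_cover\<close>). Conversely, let \<open>\<epsilon>\<close> be a Lebesgue number of the cover. The orbits
  that share the word of a given orbit and shadow it up to \<open>\<epsilon>\<close> all lie in one member of the orbit
  cover, and by maximality the orbits of a maximal separated set give in this way a subcover.
  Evaluating the infimum over each member at the orbit that produced it shows that
  \<^const>\<open>M_cover\<close> is at most the separated sum at scale \<open>\<epsilon>\<close> (\<open>M_cover_le_separated_sum\<close>).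

  So \<^const>\<open>M_cover\<close> never grows faster than the pressure, while \<^const>\<open>N_cover\<close> grows at least
  as fast as the separated sums at scale \<open>\<delta>\<close>, whose growth rate tends to the pressure. The two
  cover sums differ by a factor \<open>exp (\<tau> * k)\<close> at most, where \<open>\<tau>\<close> bounds the oscillation of \<open>g\<close> at
  the scale of the cover (\<open>N_cover_le_M_cover\<close>); by uniform continuity \<open>\<tau>\<close> tends to \<open>0\<close> with
  \<open>\<delta>\<close>, and all three families of suprema are squeezed to the pressure.

  There remains the existence of the limit in \<open>k\<close> for \<^const>\<open>N_cover\<close>. An orbit of length \<open>m + n\<close>
  splits into orbits of lengths \<open>m\<close> and \<open>n\<close> that share the point with index \<open>m\<close>, so the product of
  two subcovers would constrain this point twice and leave the orbit cover. Splitting an orbit of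
  length \<open>m + n + 1\<close> by removing its middle step avoids the overlap, at the cost of a
  constant factor (\<open>N_cover_gap_submultiplicative\<close>). Fekete's lemma tolerates this gap and this
  factor (\<open>gap_subadditive_convergent\<close>).
\<close>

section \<open>Metric geometry of the Riemann sphere\<close>

text \<open>Apart from the north pole, a point \<open>(w, t)\<close> of the unit sphere is the image of
  \<open>w / (1 - t)\<close>, the usual stereographic projection.\<close>

lemma stereo_range: "range stereo = sphere 0 1"
proof
  show "range stereo \<subseteq> sphere 0 1" by (auto simp: norm_stereo)
  show "sphere 0 1 \<subseteq> range stereo"
  proof
    fix p :: "complex \<times> real" assume p: "p \<in> sphere 0 1"
    obtain w t where wt: "p = (w, t)" by (cases p)
    have n: "(norm w)\<^sup>2 + t\<^sup>2 = 1" using p wt by (simp add: norm_prod_def)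
    show "p \<in> range stereo"
    proof (cases "t = 1")
      case True
      then show ?thesis using n wt by (auto intro!: range_eqI[of _ _ Infty])
    next
      case False
      define z where "z = (1 / (1 - t)) *\<^sub>R w"
      have "(norm z)\<^sup>2 = (norm w)\<^sup>2 / (1 - t)\<^sup>2"
        by (simp add: z_def power_divide power_mult_distrib)
      also have "(norm w)\<^sup>2 = (1 + t) * (1 - t)" using n by (simp add: algebra_simps power2_eq_square)
      finally have nz: "(norm z)\<^sup>2 = (1 + t) / (1 - t)" using False by (simp add: power2_eq_square)
      have s: "1 + (norm z)\<^sup>2 = 2 / (1 - t)" using False by (simp add: nz field_simps)
      have "(2 / (1 + (norm z)\<^sup>2)) *\<^sub>R z = w"
        unfolding s unfolding z_def using False by simp
      moreover have "((norm z)\<^sup>2 - 1) / (1 + (norm z)\<^sup>2) = t"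
        unfolding s unfolding nz using False by (simp add: field_simps)
      ultimately have "stereo (Fin z) = p" by (simp add: wt)
      then show ?thesis by (metis rangeI)
    qed
  qed
qed

text \<open>The distance of two points is a continuous function of the inner product of their
  stereographic images, and it vanishes when this product is \<open>1\<close>. So the inverse of the
  stereographic embedding is continuous on the unit sphere, which is compact.\<close>

lemma compact_riemann_sphere: "compact (UNIV :: riemann_sphere set)"
proof -
  let ?h = "inv_into UNIV stereo"
  have st: "stereo (?h u) = u" if "u \<in> sphere 0 1" for u
    using that stereo_range by (metis f_inv_into_f)
  have "continuous_on (sphere 0 1) ?h"
    unfolding continuous_on_def tendsto_dist_iff[where f="?h"]
  proof
    fix u :: "complex \<times> real" assume u: "u \<in> sphere 0 1"
    have "((\<lambda>v. arccos (v \<bullet> u)) \<longlongrightarrow> arccos (u \<bullet> u)) (at u within sphere 0 1)"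
    proof -
      have "continuous_on (sphere 0 1) (\<lambda>v. arccos (v \<bullet> u))"
      proof (intro continuous_on_arccos continuous_intros ballI)
        fix v :: "complex \<times> real" assume "v \<in> sphere 0 1"
        then show "-1 \<le> v \<bullet> u \<and> v \<bullet> u \<le> 1"
          using Cauchy_Schwarz_ineq2[of v u] u by auto
      qed
      then show ?thesis using u by (auto simp: continuous_on_def)
    qed
    moreover have "arccos (u \<bullet> u) = 0" using u by (simp add: norm_eq_1)
    moreover have "\<forall>\<^sub>F v in at u within sphere 0 1. arccos (v \<bullet> u) = dist (?h v) (?h u)"
      using u by (auto simp: eventually_at_filter dist_riemann_sphere_def st)
    ultimately show "((\<lambda>v. dist (?h v) (?h u)) \<longlongrightarrow> 0) (at u within sphere 0 1)"
      using Lim_transform_eventually by fastforce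
  qed
  then have "compact (?h ` sphere 0 1)" by (intro compact_continuous_image) auto
  moreover have "?h ` sphere 0 1 = UNIV"
    unfolding stereo_range[symmetric] using inj_stereo by simp
  ultimately show ?thesis by simp
qed

lemma bounded_riemann_sphere: "bounded (A :: riemann_sphere set)"
  using compact_imp_bounded[OF compact_riemann_sphere] bounded_subset by blast

text \<open>A real supremum is only meaningful over a bounded set; here the diameters are
  bounded because the whole sphere is.\<close>

lemma dist_le_cover_diam:
  assumes "U \<in> \<U>" "x \<in> U" "y \<in> U"
  shows "dist x y \<le> cover_diam \<U>"
proof -
  have "bdd_above (diameter ` \<U>)"
    by (rule bdd_aboveI2[of _ _ "diameter (UNIV :: riemann_sphere set)"])
       (rule diameter_subset, auto intro: bounded_riemann_sphere)
  then have "diameter U \<le> cover_diam \<U>"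
    unfolding cover_diam_def using assms(1) by (intro cSUP_upper)
  then show ?thesis
    using diameter_bounded_bound[OF bounded_riemann_sphere assms(2,3)] by simp
qed

lemma diameter_le_dist:
  fixes S :: "'a::metric_space set"
  assumes "0 \<le> d" "\<And>x y. x \<in> S \<Longrightarrow> y \<in> S \<Longrightarrow> dist x y \<le> d"
  shows "diameter S \<le> d"
  using assms unfolding diameter_def by (auto intro!: cSUP_least)

text \<open>This keeps the suprema over fine covers from ranging over the empty set, where they would
  be \<open>- \<infinity>\<close>.\<close>

lemma small_cover_exists:
  assumes "\<delta> > 0"
  shows "\<exists>\<U>. open_cover \<U> \<and> cover_diam \<U> < \<delta>"
proof (intro exI conjI)
  let ?U = "range (\<lambda>x. ball x (\<delta> / 4))"
  show "open_cover ?U" using assms by (force simp: open_cover_def)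
  have "diameter (ball x (\<delta> / 4)) \<le> \<delta> / 2" for x :: riemann_sphere
  proof (rule diameter_le_dist)
    fix y z assume "y \<in> ball x (\<delta> / 4)" "z \<in> ball x (\<delta> / 4)"
    then show "dist y z \<le> \<delta> / 2"
      using dist_triangle2[of y z x] by (simp add: dist_commute)
  qed (use assms in simp)
  then have "cover_diam ?U \<le> \<delta> / 2"
    unfolding cover_diam_def by (intro cSUP_least) auto
  then show "cover_diam ?U < \<delta>" using assms by simp
qed

text \<open>Closed balls are the right shape here: two orbits that fail to be separated at scale
  \<open>\<epsilon>\<close> may be at distance exactly \<open>\<epsilon>\<close>.\<close>

lemma open_cover_Lebesgue_number:
  assumes "open_cover \<U>"
  shows "\<exists>\<epsilon>>0. \<forall>x. \<exists>U\<in>\<U>. cball x \<epsilon> \<subseteq> U"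
proof -
  have "\<U> \<noteq> {}" using assms by (auto simp: open_cover_def)
  then obtain d where d: "d > 0" "\<And>T. diameter T < d \<Longrightarrow> \<exists>U\<in>\<U>. T \<subseteq> U"
    using Lebesgue_number_lemma[OF compact_riemann_sphere, of \<U>] assms
    by (auto simp: open_cover_def)
  have "diameter (cball x (d / 4)) \<le> d / 2" for x :: riemann_sphere
  proof (rule diameter_le_dist)
    fix y z assume "y \<in> cball x (d / 4)" "z \<in> cball x (d / 4)"
    then show "dist y z \<le> d / 2"
      using dist_triangle2[of y z x] by (simp add: dist_commute)
  qed (use d in simp)
  then have "diameter (cball x (d / 4)) < d" for x :: riemann_sphere
    using d(1) by (smt (verit) field_sum_of_halves)
  then show ?thesis using d by (intro exI[of _ "d / 4"]) auto
qed

lemma continuous_oscillation: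
  fixes g :: "riemann_sphere \<Rightarrow> real"
  assumes "continuous_on UNIV g" "e > 0"
  shows "\<exists>d>0. \<forall>x y. dist x y < d \<longrightarrow> \<bar>g x - g y\<bar> < e"
  using compact_uniformly_continuous[OF assms(1) compact_riemann_sphere] assms(2)
  unfolding uniformly_continuous_on_def by (simp add: dist_real_def) (metis dist_commute)

lemma continuous_bounded:
  fixes g :: "riemann_sphere \<Rightarrow> real"
  assumes "continuous_on UNIV g"
  shows "\<exists>G. \<forall>x. \<bar>g x\<bar> \<le> G"
proof -
  have "bounded (range g)"
    using compact_imp_bounded compact_continuous_image[OF assms compact_riemann_sphere] by blast
  then show ?thesis by (auto simp: bounded_iff)
qed

section \<open>Fekete's lemma for sequences that are subadditive with a gap\<close>

text \<open>Fekete's lemma. If \<open>b p / p\<close> is close to the infimum \<open>L\<close> of all quotients, then cutting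
  a large \<open>n\<close> into \<open>q\<close> blocks of length \<open>p\<close> and a remainder bounds \<open>b n / n\<close> by \<open>b p / p\<close> up to
  an error of order \<open>1 / n\<close>.\<close>

lemma subadditive_convergent:
  fixes b :: "nat \<Rightarrow> real"
  assumes sub: "\<And>p q. 0 < p \<Longrightarrow> 0 < q \<Longrightarrow> b (p + q) \<le> b p + b q"
    and low: "\<And>n. 0 < n \<Longrightarrow> - (c * real n) \<le> b n"
  shows "convergent (\<lambda>n. b n / real n)"
proof -
  define L where "L = (INF n\<in>{0<..}. b n / real n)"
  have "bdd_below ((\<lambda>n. b n / real n) ` {0<..})"
  proof (rule bdd_belowI2)
    fix n :: nat assume "n \<in> {0<..}"
    then show "-c \<le> b n / real n" using low[of n] by (simp add: field_simps)
  qed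
  then have L: "L \<le> b n / real n" if "n > 0" for n
    unfolding L_def using that by (intro cINF_lower) auto
  have "(\<lambda>n. b n / real n) \<longlonglongrightarrow> L"
  proof (rule order_tendstoI)
    fix l assume "l < L"
    then show "\<forall>\<^sub>F n in sequentially. l < b n / real n"
    proof (intro eventually_sequentiallyI[of 1])
      fix n :: nat assume "1 \<le> n"
      then show "l < b n / real n" using L[of n] \<open>l < L\<close> by simp
    qed
  next
    fix l assume "L < l"
    then obtain p where p: "p > 0" "b p / real p < l"
      unfolding L_def using cInf_lessD[of "(\<lambda>n. b n / real n) ` {0<..}" l]
      by (auto simp: image_def)
    have step: "b (q * p + r) \<le> real q * b p + b r" if "r > 0" for q r
    proof (induction q)
      case (Suc q)
      have "b (Suc q * p + r) = b (p + (q * p + r))" by (simp add: algebra_simps)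
      also have "\<dots> \<le> b p + b (q * p + r)" using p that by (intro sub) auto
      finally show ?case using Suc by (simp add: algebra_simps)
    qed simp
    define B where "B = (\<Sum>r\<le>p. \<bar>b r\<bar>)"
    have B: "b r \<le> B" if "r \<le> p" for r
      using member_le_sum[of r "{..p}" "\<lambda>r. \<bar>b r\<bar>"] that by (simp add: B_def)
    have bound: "b n / real n \<le> b p / real p + (B + \<bar>b p\<bar>) / real n" if n: "n > 0" for n
    proof -
      \<comment> \<open>The remainder is taken in \<open>{1..p}\<close>, since subadditivity gives no control over \<open>b 0\<close>.\<close>
      define q r where "q = (n - 1) div p" and "r = (n - 1) mod p + 1"
      have nqr: "n = q * p + r" and r: "r > 0" "r \<le> p"
        using n p by (auto simp: q_def r_def Suc_leI)
      have "- (real r * b p) \<le> real p * \<bar>b p\<bar>"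
      proof -
        have "real r * (- b p) \<le> real r * \<bar>b p\<bar>" by (intro mult_left_mono) auto
        also have "\<dots> \<le> real p * \<bar>b p\<bar>" using r by (intro mult_right_mono) auto
        finally show ?thesis by simp
      qed
      moreover have "real q * real p = real n - real r" using nqr by simp
      ultimately have "real p * (real q * b p) \<le> real n * b p + real p * \<bar>b p\<bar>"
        by (simp add: left_diff_distrib mult.assoc[symmetric] mult.commute[of "real p" "real q"])
      moreover have "b n \<le> real q * b p + B" using step[OF r(1), of q] B[OF r(2)] nqr by simp
      then have "real p * b n \<le> real p * (real q * b p + B)" by (intro mult_left_mono) auto
      ultimately have "real p * b n \<le> real n * b p + real p * (B + \<bar>b p\<bar>)"
        by (simp add: algebra_simps)
      then show ?thesis using p n by (simp add: field_simps)
    qed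
    have "(\<lambda>n. b p / real p + (B + \<bar>b p\<bar>) / real n) \<longlonglongrightarrow> b p / real p + 0"
      by (intro tendsto_add tendsto_const lim_const_over_n)
    then have "\<forall>\<^sub>F n in sequentially. b p / real p + (B + \<bar>b p\<bar>) / real n < l"
      using p(2) by (intro order_tendstoD(2)) auto
    then show "\<forall>\<^sub>F n in sequentially. b n / real n < l"
    proof (rule eventually_rev_mp, intro eventually_sequentiallyI[of 1] impI)
      fix n :: nat assume "1 \<le> n" "b p / real p + (B + \<bar>b p\<bar>) / real n < l"
      then show "b n / real n < l" using bound[of n] by simp
    qed
  qed
  then show ?thesis by (auto simp: convergent_def)
qed

text \<open>Shifting the index by one absorbs the gap, and adding \<open>c\<close> absorbs the defect, so that
  the sequence \<open>b\<close> below is subadditive in the usual sense.\<close>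

lemma gap_subadditive_convergent:
  fixes a :: "nat \<Rightarrow> real"
  assumes sub: "\<And>m n. a (m + n + 1) \<le> a m + a n + c"
    and low: "\<And>n. - (d * real n) \<le> a n"
  shows "convergent (\<lambda>k. a k / real k)"
proof -
  define b where "b = (\<lambda>n. a (n - 1) + c)"
  have "convergent (\<lambda>n. b n / real n)"
  proof (rule subadditive_convergent)
    fix p q :: nat assume pq: "0 < p" "0 < q"
    then have eq: "p + q - 1 = (p - 1) + (q - 1) + 1" by simp
    have "a (p + q - 1) \<le> a (p - 1) + a (q - 1) + c"
      unfolding eq by (rule sub)
    then show "b (p + q) \<le> b p + b q" unfolding b_def by linarith
  next
    fix n :: nat assume n: "0 < n"
    have "- (d * real (n - 1)) \<ge> - (\<bar>d\<bar> * real n)"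
      using mult_mono[of d "\<bar>d\<bar>" "real (n - 1)" "real n"] by simp
    moreover have "- (\<bar>c\<bar> * real n) \<le> c" using n mult_left_mono[of 1 "real n" "\<bar>c\<bar>"] by linarith
    ultimately show "- ((\<bar>d\<bar> + \<bar>c\<bar>) * real n) \<le> b n"
      using low[of "n - 1"] by (simp add: b_def distrib_right)
  qed
  then obtain L where "(\<lambda>n. b n / real n) \<longlonglongrightarrow> L" by (auto simp: convergent_def)
  then have "(\<lambda>n. b (Suc n) / real (Suc n)) \<longlonglongrightarrow> L" by (rule LIMSEQ_Suc)
  then have "(\<lambda>k. b (Suc k) / real (Suc k) * (1 + 1 / real k) - c / real k) \<longlonglongrightarrow> L * (1 + 0) - 0"
    by (intro tendsto_intros lim_const_over_n)
  moreover have "\<forall>\<^sub>F k in sequentially.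
      b (Suc k) / real (Suc k) * (1 + 1 / real k) - c / real k = a k / real k"
    using eventually_gt_at_top[of "0::nat"]
  proof eventually_elim
    fix k :: nat assume "k > 0"
    then have "1 + 1 / real k = real (Suc k) / real k" by (simp add: field_simps)
    then show "b (Suc k) / real (Suc k) * (1 + 1 / real k) - c / real k = a k / real k"
      by (simp add: b_def diff_divide_distrib[symmetric])
  qed
  ultimately have "(\<lambda>k. a k / real k) \<longlonglongrightarrow> L * (1 + 0) - 0"
    by (rule Lim_transform_eventually)
  then show ?thesis by (auto simp: convergent_def)
qed

section \<open>Cylinders of orbits and finite subcovers\<close>

text \<open>Only the values of \<open>U\<close> on \<open>{..k}\<close> and of \<open>j\<close> on \<open>{1..k}\<close> count; total functions spare the
  side conditions on domains when words are concatenated.\<close>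

definition cylinder ::
  "nat \<Rightarrow> (nat \<Rightarrow> (riemann_sphere \<times> riemann_sphere) set) \<Rightarrow> nat
    \<Rightarrow> (nat \<Rightarrow> riemann_sphere set) \<Rightarrow> (nat \<Rightarrow> nat) \<Rightarrow> orbit set" where
  "cylinder N F k U j =
     {X \<in> orbits N F k. (\<forall>i\<le>k. Pi_coord i X \<in> U i) \<and> (\<forall>i\<in>{1..k}. proj_coord i X = j i)}"

lemma orbit_cover_eq_cylinders:
  "orbit_cover N F k \<U> =
     {cylinder N F k U j | U j. (\<forall>i\<le>k. U i \<in> \<U>) \<and> (\<forall>i\<in>{1..k}. j i \<in> {1..N})}"
  by (simp add: orbit_cover_def cylinder_def)

lemma cylinder_in_orbit_cover:
  assumes "\<And>i. i \<le> k \<Longrightarrow> U i \<in> \<U>" "\<And>i. i \<in> {1..k} \<Longrightarrow> j i \<in> {1..N}"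
  shows "cylinder N F k U j \<in> orbit_cover N F k \<U>"
  unfolding orbit_cover_eq_cylinders using assms by blast

lemma orbits_proj_coord: "X \<in> orbits N F k \<Longrightarrow> i \<in> {1..k} \<Longrightarrow> proj_coord i X \<in> {1..N}"
  by (simp add: orbits_def)

lemma orbit_cover_mono:
  assumes "\<V> \<subseteq> \<U>"
  shows "orbit_cover N F k \<V> \<subseteq> orbit_cover N F k \<U>"
  unfolding orbit_cover_eq_cylinders using assms by blast

lemma Union_orbit_cover:
  assumes "\<Union>\<U> = UNIV"
  shows "\<Union>(orbit_cover N F k \<U>) = orbits N F k"
proof
  show "\<Union>(orbit_cover N F k \<U>) \<subseteq> orbits N F k"
    by (auto simp: orbit_cover_def)
  show "orbits N F k \<subseteq> \<Union>(orbit_cover N F k \<U>)"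
  proof
    fix X assume X: "X \<in> orbits N F k"
    have "\<forall>x. \<exists>U. U \<in> \<U> \<and> x \<in> U" using assms by (metis UNIV_I Union_iff)
    then obtain c where c: "c x \<in> \<U>" "x \<in> c x" for x by metis
    have "cylinder N F k (\<lambda>i. c (Pi_coord i X)) (\<lambda>i. proj_coord i X) \<in> orbit_cover N F k \<U>"
      by (intro cylinder_in_orbit_cover c orbits_proj_coord[OF X])
    then show "X \<in> \<Union>(orbit_cover N F k \<U>)"
      by (rule UnionI) (use X c in \<open>auto simp: cylinder_def\<close>)
  qed
qed

text \<open>A cylinder is determined by finitely many choices from a finite set.\<close>

lemma finite_orbit_cover:
  assumes "finite \<U>"
  shows "finite (orbit_cover N F k \<U>)"
proof (rule finite_subset)
  let ?I = "({..k} \<rightarrow>\<^sub>E \<U>) \<times> ({1..k} \<rightarrow>\<^sub>E {1..N})"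
  show "finite ((\<lambda>(U, j). cylinder N F k U j) ` ?I)"
    using assms by (intro finite_imageI finite_cartesian_product finite_PiE) auto
  show "orbit_cover N F k \<U> \<subseteq> (\<lambda>(U, j). cylinder N F k U j) ` ?I"
  proof
    fix \<gamma> assume "\<gamma> \<in> orbit_cover N F k \<U>"
    then obtain U j where \<gamma>: "\<gamma> = cylinder N F k U j"
      and Uj: "\<forall>i\<le>k. U i \<in> \<U>" "\<forall>i\<in>{1..k}. j i \<in> {1..N}"
      unfolding orbit_cover_eq_cylinders by blast
    have "\<gamma> = cylinder N F k (restrict U {..k}) (restrict j {1..k})"
      by (auto simp: \<gamma> cylinder_def)
    moreover have "(restrict U {..k}, restrict j {1..k}) \<in> ?I"
      using Uj by (intro SigmaI restrict_PiE_iff[THEN iffD2]) auto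
    ultimately show "\<gamma> \<in> (\<lambda>(U, j). cylinder N F k U j) ` ?I"
      by (intro rev_image_eqI[of "(restrict U {..k}, restrict j {1..k})"]) auto
  qed
qed

text \<open>The finite subcover comes from the sphere itself: a finite subcover of \<open>\<U>\<close> has a finite
  orbit cover, and every orbit lies in one of its cylinders.\<close>

lemma finite_subcover_exists:
  assumes "open_cover \<U>"
  shows "finite_subcovers N F k \<U> \<noteq> {}"
proof -
  obtain \<V> where \<V>: "\<V> \<subseteq> \<U>" "finite \<V>" "\<Union>\<V> = UNIV"
  proof (rule compactE[OF compact_riemann_sphere, of \<U>])
    show "UNIV \<subseteq> \<Union>\<U>" "\<And>U. U \<in> \<U> \<Longrightarrow> open U"
      using assms by (auto simp: open_cover_def)
  qed (use that in blast)
  then have "orbit_cover N F k \<V> \<in> finite_subcovers N F k \<U>"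
    by (simp add: finite_subcovers_def finite_orbit_cover Union_orbit_cover orbit_cover_mono)
  then show ?thesis by blast
qed

text \<open>Since the first projection maps \<open>F 1\<close> onto the sphere, some function \<open>s\<close> satisfies
  \<open>(x, s x) \<in> F 1\<close> for all \<open>x\<close>; its iterates form an orbit with constant word. This keeps the
  cover sums away from \<open>0\<close>.\<close>

lemma orbits_nonempty:
  assumes "holomorphic_correspondence N F"
  shows "orbits N F k \<noteq> {}"
proof -
  have "1 \<in> {1..N}" and surj: "fst ` F 1 = UNIV"
    using assms by (auto simp: holomorphic_correspondence_def)
  have "\<forall>x. \<exists>y. (x, y) \<in> F 1"
  proof
    fix x
    have "x \<in> fst ` F 1" using surj by simp
    then show "\<exists>y. (x, y) \<in> F 1" by auto
  qed
  then obtain s where s: "(x, s x) \<in> F 1" for x by metis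
  define X where "X = (map (\<lambda>i. (s ^^ i) Infty) [0..<k + 1], replicate k (1::nat))"
  have "X \<in> orbits N F k"
    unfolding orbits_def
  proof (intro CollectI conjI ballI)
    fix r assume r: "r \<in> {1..k}"
    then obtain i where i: "r = Suc i" by (cases r) auto
    show "proj_coord r X \<in> {1..N}"
      using r \<open>1 \<in> {1..N}\<close> by (simp add: X_def proj_coord_def i)
    show "(Pi_coord (r - 1) X, Pi_coord r X) \<in> F (proj_coord r X)"
      using r s[of "(s ^^ i) Infty"] by (simp add: X_def proj_coord_def Pi_coord_def i nth_append del: upt_Suc)
  qed (simp_all add: X_def)
  then show ?thesis by blast
qed

section \<open>A priori bounds on the cover sums\<close>

lemma E_weight_upper:
  assumes "\<And>x. \<bar>g x\<bar> \<le> G"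
  shows "E_weight k g X \<le> exp (G * real k)"
proof -
  have "(\<Sum>i<k. g (Pi_coord i X)) \<le> of_nat (card {..<k}) * G"
    by (rule sum_bounded_above) (use assms abs_le_D1 in blast)
  then show ?thesis by (simp add: E_weight_def mult.commute)
qed

lemma E_weight_lower:
  assumes "\<And>x. \<bar>g x\<bar> \<le> G"
  shows "exp (- (G * real k)) \<le> E_weight k g X"
proof -
  have "(\<Sum>i<k. g (Pi_coord i X)) \<ge> of_nat (card {..<k}) * (- G)"
    by (rule sum_bounded_below) (use assms abs_le_D2 in \<open>smt (verit)\<close>)
  then show ?thesis by (simp add: E_weight_def mult.commute)
qed

lemma sum_SUP_E_weight_finite:
  assumes "\<And>x. \<bar>g x\<bar> \<le> G" "finite C"
  shows "(\<Sum>\<gamma>\<in>C. SUP X\<in>\<gamma>. ennreal (E_weight k g X)) < \<infinity>"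
proof -
  have "(SUP X\<in>\<gamma>. ennreal (E_weight k g X)) < top" for \<gamma>
  proof -
    have "(SUP X\<in>\<gamma>. ennreal (E_weight k g X)) \<le> ennreal (exp (G * real k))"
      by (intro SUP_least ennreal_leI E_weight_upper assms(1))
    also have "\<dots> < top" by simp
    finally show ?thesis .
  qed
  then show ?thesis using assms(2) by simp
qed

text \<open>With the lower bound below, this makes the logarithm of \<^const>\<open>N_cover\<close> a real number,
  so that Fekete's lemma for real sequences applies to it.\<close>

lemma N_cover_finite:
  assumes "\<And>x. \<bar>g x\<bar> \<le> G" "finite_subcovers N F k \<U> \<noteq> {}"
  shows "N_cover N F k g \<U> < \<infinity>"
proof -
  obtain C where C: "C \<in> finite_subcovers N F k \<U>" using assms(2) by blast
  then have "N_cover N F k g \<U> \<le> (\<Sum>\<gamma>\<in>C. SUP X\<in>\<gamma>. ennreal (E_weight k g X))"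
    unfolding N_cover_def by (rule INF_lower)
  also have "\<dots> < \<infinity>" using C assms(1) by (intro sum_SUP_E_weight_finite) (auto simp: finite_subcovers_def)
  finally show ?thesis .
qed

text \<open>Some member of each subcover contains an orbit, and the weight of that orbit alone already
  reaches the bound.\<close>

lemma N_cover_lower:
  assumes "\<And>x. \<bar>g x\<bar> \<le> G" "orbits N F k \<noteq> {}"
  shows "ennreal (exp (- (G * real k))) \<le> N_cover N F k g \<U>"
  unfolding N_cover_def
proof (rule INF_greatest)
  fix C assume C: "C \<in> finite_subcovers N F k \<U>"
  obtain X where "X \<in> orbits N F k" using assms(2) by blast
  then obtain \<gamma> where \<gamma>: "\<gamma> \<in> C" "X \<in> \<gamma>" using C by (auto simp: finite_subcovers_def)
  have "ennreal (exp (- (G * real k))) \<le> ennreal (E_weight k g X)"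
    by (intro ennreal_leI E_weight_lower assms(1))
  also have "\<dots> \<le> (SUP X\<in>\<gamma>. ennreal (E_weight k g X))" using \<gamma>(2) by (rule SUP_upper)
  also have "\<dots> \<le> (\<Sum>\<gamma>\<in>C. SUP X\<in>\<gamma>. ennreal (E_weight k g X))"
    using C \<gamma>(1) by (intro member_le_sum) (auto simp: finite_subcovers_def)
  finally show "ennreal (exp (- (G * real k))) \<le> (\<Sum>\<gamma>\<in>C. SUP X\<in>\<gamma>. ennreal (E_weight k g X))" .
qed

section \<open>Splicing orbits across a gap\<close>

definition orbit_take :: "nat \<Rightarrow> orbit \<Rightarrow> orbit" where
  "orbit_take m X = (take (m + 1) (fst X), take m (snd X))"

definition orbit_drop :: "nat \<Rightarrow> orbit \<Rightarrow> orbit" where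
  "orbit_drop m X = (drop m (fst X), drop m (snd X))"

lemma Pi_coord_take: "i \<le> m \<Longrightarrow> Pi_coord i (orbit_take m X) = Pi_coord i X"
  by (simp add: Pi_coord_def orbit_take_def)

lemma proj_coord_take: "i \<in> {1..m} \<Longrightarrow> proj_coord i (orbit_take m X) = proj_coord i X"
  by (auto simp: proj_coord_def orbit_take_def)

lemma Pi_coord_drop: "m \<le> length (fst X) \<Longrightarrow> Pi_coord i (orbit_drop m X) = Pi_coord (m + i) X"
  by (simp add: Pi_coord_def orbit_drop_def)

lemma proj_coord_drop:
  "m \<le> length (snd X) \<Longrightarrow> 1 \<le> i \<Longrightarrow> proj_coord i (orbit_drop m X) = proj_coord (m + i) X"
  by (simp add: proj_coord_def orbit_drop_def)

lemma orbit_take_in_orbits: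
  assumes "X \<in> orbits N F k" "m \<le> k"
  shows "orbit_take m X \<in> orbits N F m"
  using assms unfolding orbits_def
  by (auto simp: Pi_coord_take proj_coord_take) (auto simp: orbit_take_def)

text \<open>Dropping the first \<open>m\<close> points together with the first \<open>m\<close> letters removes the first \<open>m\<close>
  steps of the orbit, so the point with index \<open>m\<close> becomes the initial one.\<close>

lemma orbit_drop_in_orbits:
  assumes X: "X \<in> orbits N F (m + n)"
  shows "orbit_drop m X \<in> orbits N F n"
proof -
  have l: "m \<le> length (fst X)" "m \<le> length (snd X)" using X by (auto simp: orbits_def)
  show ?thesis
    unfolding orbits_def
  proof (intro CollectI conjI ballI)
    fix r assume r: "r \<in> {1..n}"
    then have *: "m + r \<in> {1..m + n}" "m + (r - 1) = m + r - 1" by auto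
    show "proj_coord r (orbit_drop m X) \<in> {1..N}"
      using r X * l by (auto simp: proj_coord_drop orbits_def)
    show "(Pi_coord (r - 1) (orbit_drop m X), Pi_coord r (orbit_drop m X)) \<in> F (proj_coord r (orbit_drop m X))"
      using r X * l by (simp add: proj_coord_drop Pi_coord_drop orbits_def)
  qed (use X in \<open>auto simp: orbits_def orbit_drop_def\<close>)
qed

text \<open>The weight of an orbit does not see its last point. The initial piece therefore accounts
  for the indices below \<open>m\<close> and the final piece for those above \<open>m\<close>, which leaves the factor
  at \<open>m\<close>.\<close>

lemma E_weight_split:
  assumes "X \<in> orbits N F (m + n + 1)"
  shows "E_weight (m + n + 1) g X =
    exp (g (Pi_coord m X)) * E_weight m g (orbit_take m X) * E_weight n g (orbit_drop (m + 1) X)"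
proof -
  have l: "m + 1 \<le> length (fst X)" using assms by (auto simp: orbits_def)
  have split: "(\<Sum>i<m + n' + 1. f i) = (\<Sum>i<m. f i) + f m + (\<Sum>i<n'. f (m + 1 + i))"
    for n' and f :: "nat \<Rightarrow> real"
    by (induction n') (simp_all add: algebra_simps)
  have "(\<Sum>i<m + n + 1. g (Pi_coord i X)) =
      (\<Sum>i<m. g (Pi_coord i X)) + g (Pi_coord m X) + (\<Sum>i<n. g (Pi_coord (m + 1 + i) X))"
    by (rule split)
  also have "(\<Sum>i<m. g (Pi_coord i X)) = (\<Sum>i<m. g (Pi_coord i (orbit_take m X)))"
    by (intro sum.cong) (auto simp: Pi_coord_take)
  also have "(\<Sum>i<n. g (Pi_coord (m + 1 + i) X)) = (\<Sum>i<n. g (Pi_coord i (orbit_drop (m + 1) X)))"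
    by (simp only: Pi_coord_drop[OF l])
  finally show ?thesis by (simp add: E_weight_def exp_add mult_ac)
qed

text \<open>One step, of type \<open>t\<close>, separates the two pieces, so that they have no point in common.\<close>

definition orbit_splice ::
  "nat \<Rightarrow> (nat \<Rightarrow> (riemann_sphere \<times> riemann_sphere) set) \<Rightarrow> nat \<Rightarrow> nat
    \<Rightarrow> orbit set \<Rightarrow> nat \<Rightarrow> orbit set \<Rightarrow> orbit set" where
  "orbit_splice N F m n \<gamma> t \<delta> = {X \<in> orbits N F (m + n + 1).
     orbit_take m X \<in> \<gamma> \<and> proj_coord (m + 1) X = t \<and> orbit_drop (m + 1) X \<in> \<delta>}"

text \<open>The initial piece occupies the points \<open>0, \<dots>, m\<close> and the final piece the points
  \<open>m + 1, \<dots>, m + n + 1\<close>. No point is constrained twice, so concatenating the two sequences of sets,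
  and the words with \<open>t\<close> in between, describes the splice as a single cylinder.\<close>

lemma splice_in_orbit_cover:
  assumes \<gamma>: "\<gamma> \<in> orbit_cover N F m \<U>" and \<delta>: "\<delta> \<in> orbit_cover N F n \<U>" and t: "t \<in> {1..N}"
  shows "orbit_splice N F m n \<gamma> t \<delta> \<in> orbit_cover N F (m + n + 1) \<U>"
proof -
  obtain U j where \<gamma>': "\<gamma> = cylinder N F m U j"
    and Uj: "\<forall>i\<le>m. U i \<in> \<U>" "\<forall>i\<in>{1..m}. j i \<in> {1..N}"
    using \<gamma> unfolding orbit_cover_eq_cylinders by blast
  obtain V l where \<delta>': "\<delta> = cylinder N F n V l"
    and Vl: "\<forall>i\<le>n. V i \<in> \<U>" "\<forall>i\<in>{1..n}. l i \<in> {1..N}"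
    using \<delta> unfolding orbit_cover_eq_cylinders by blast
  define W where "W = (\<lambda>i. if i \<le> m then U i else V (i - (m + 1)))"
  define h where "h = (\<lambda>i. if i \<le> m then j i else if i = m + 1 then t else l (i - (m + 1)))"
  have past: "\<exists>i'. i = m + 1 + i'" if "i > m" for i
    using that by (metis Suc_eq_plus1 Suc_le_eq le_iff_add)
  have all_split: "(\<forall>i\<le>m + n + 1. P i) \<longleftrightarrow> (\<forall>i\<le>m. P i) \<and> (\<forall>i\<le>n. P (m + 1 + i))" for P
  proof -
    have "P i" if P: "\<forall>i\<le>m. P i" "\<forall>i\<le>n. P (m + 1 + i)" and i: "i \<le> m + n + 1" for i
    proof (cases "i \<le> m")
      case False
      then obtain i' where "i = m + 1 + i'" using past[of i] by auto
      then show ?thesis using P(2) i by simp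
    qed (use P in blast)
    moreover have "m + 1 + i \<le> m + n + 1" if "i \<le> n" for i using that by simp
    moreover have "i \<le> m + n + 1" if "i \<le> m" for i using that by simp
    ultimately show ?thesis by blast
  qed
  have ball_split: "(\<forall>i\<in>{1..m + n + 1}. P i) \<longleftrightarrow>
      (\<forall>i\<in>{1..m}. P i) \<and> P (m + 1) \<and> (\<forall>i\<in>{1..n}. P (m + 1 + i))" for P
  proof -
    have "P i" if P: "\<forall>i\<in>{1..m}. P i" "P (m + 1)" "\<forall>i\<in>{1..n}. P (m + 1 + i)"
      and i: "i \<in> {1..m + n + 1}" for i
    proof -
      consider "i \<le> m" | "i = m + 1" | "i > m + 1" by linarith
      then show "P i"
      proof cases
        case 1
        then show ?thesis using P(1) i by simp
      next
        case 2
        then show ?thesis using P(2) by simp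
      next
        case 3
        then obtain i' where "i = m + 1 + i'" using past[of i] by auto
        then show ?thesis using P(3) i 3 by simp
      qed
    qed
    moreover have "m + 1 + i \<in> {1..m + n + 1}" if "i \<in> {1..n}" for i using that by simp
    moreover have "i \<in> {1..m + n + 1}" if "i \<in> {1..m}" for i using that by simp
    moreover have "m + 1 \<in> {1..m + n + 1}" by simp
    ultimately show ?thesis by blast
  qed
  have "orbit_splice N F m n \<gamma> t \<delta> = cylinder N F (m + n + 1) W h"
  proof -
    have "orbit_take m X \<in> \<gamma> \<and> proj_coord (m + 1) X = t \<and> orbit_drop (m + 1) X \<in> \<delta> \<longleftrightarrow>
        (\<forall>i\<le>m + n + 1. Pi_coord i X \<in> W i) \<and> (\<forall>i\<in>{1..m + n + 1}. proj_coord i X = h i)"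
      if X: "X \<in> orbits N F (m + n + 1)" for X
    proof -
      have len: "m + 1 \<le> length (fst X)" "m + 1 \<le> length (snd X)" using X by (auto simp: orbits_def)
      have "orbit_take m X \<in> orbits N F m" using X by (rule orbit_take_in_orbits) simp
      moreover have "orbit_drop (m + 1) X \<in> orbits N F n"
        using X by (intro orbit_drop_in_orbits) (simp add: add_ac)
      moreover have "Pi_coord i (orbit_drop (Suc m) X) = Pi_coord (Suc (m + i)) X" for i
        using Pi_coord_drop[OF len(1), of i] by simp
      moreover have "proj_coord i (orbit_drop (Suc m) X) = proj_coord (Suc (m + i)) X"
        if "Suc 0 \<le> i" for i
        using proj_coord_drop[OF len(2), of i] that by simp
      ultimately show ?thesis
        unfolding all_split ball_split \<gamma>' \<delta>' cylinder_def
        by (auto simp: Pi_coord_take proj_coord_take W_def h_def)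
    qed
    then show ?thesis unfolding orbit_splice_def cylinder_def by blast
  qed
  also have "\<dots> \<in> orbit_cover N F (m + n + 1) \<U>"
  proof (rule cylinder_in_orbit_cover)
    show "W i \<in> \<U>" if "i \<le> m + n + 1" for i
      using that Uj Vl by (simp add: W_def)
    show "h i \<in> {1..N}" if "i \<in> {1..m + n + 1}" for i
    proof -
      have "i \<in> {1..m} \<or> i = m + 1 \<or> i - (m + 1) \<in> {1..n} \<and> i > m + 1"
        using that by auto
      then show ?thesis
        using Uj(2) Vl(2) t by (elim disjE) (simp_all add: h_def)
    qed
  qed
  finally show ?thesis .
qed

lemma splice_subcover:
  assumes C: "C \<in> finite_subcovers N F m \<U>" and D: "D \<in> finite_subcovers N F n \<U>"
  shows "(\<lambda>(\<gamma>, t, \<delta>). orbit_splice N F m n \<gamma> t \<delta>) ` (C \<times> {1..N} \<times> D)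
    \<in> finite_subcovers N F (m + n + 1) \<U>"
proof -
  have "\<exists>\<gamma>\<in>C. \<exists>t\<in>{1..N}. \<exists>\<delta>\<in>D. X \<in> orbit_splice N F m n \<gamma> t \<delta>"
    if X: "X \<in> orbits N F (m + n + 1)" for X
  proof -
    have "orbit_take m X \<in> orbits N F m" using X by (rule orbit_take_in_orbits) simp
    moreover have "orbit_drop (m + 1) X \<in> orbits N F n"
      using X by (intro orbit_drop_in_orbits) (simp add: add_ac)
    ultimately obtain \<gamma> \<delta> where "\<gamma> \<in> C" "orbit_take m X \<in> \<gamma>" "\<delta> \<in> D" "orbit_drop (m + 1) X \<in> \<delta>"
      using C D unfolding finite_subcovers_def by blast
    moreover have "proj_coord (m + 1) X \<in> {1..N}"
      using X by (intro orbits_proj_coord) auto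
    ultimately show ?thesis using X unfolding orbit_splice_def by blast
  qed
  then have "orbits N F (m + n + 1)
      \<subseteq> \<Union>((\<lambda>(\<gamma>, t, \<delta>). orbit_splice N F m n \<gamma> t \<delta>) ` (C \<times> {1..N} \<times> D))"
    by fastforce
  moreover have "\<Union>((\<lambda>(\<gamma>, t, \<delta>). orbit_splice N F m n \<gamma> t \<delta>) ` (C \<times> {1..N} \<times> D))
      \<subseteq> orbits N F (m + n + 1)"
    by (auto simp: orbit_splice_def)
  moreover have "(\<lambda>(\<gamma>, t, \<delta>). orbit_splice N F m n \<gamma> t \<delta>) ` (C \<times> {1..N} \<times> D)
      \<subseteq> orbit_cover N F (m + n + 1) \<U>"
  proof -
    have "C \<subseteq> orbit_cover N F m \<U>" "D \<subseteq> orbit_cover N F n \<U>"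
      using C D by (auto simp: finite_subcovers_def)
    then have "orbit_splice N F m n \<gamma> t \<delta> \<in> orbit_cover N F (m + n + 1) \<U>"
      if "\<gamma> \<in> C" "t \<in> {1..N}" "\<delta> \<in> D" for \<gamma> t \<delta>
      using that by (intro splice_in_orbit_cover) blast+
    then show ?thesis by auto
  qed
  moreover have "finite ((\<lambda>(\<gamma>, t, \<delta>). orbit_splice N F m n \<gamma> t \<delta>) ` (C \<times> {1..N} \<times> D))"
    using C D by (intro finite_imageI finite_cartesian_product) (auto simp: finite_subcovers_def)
  ultimately show ?thesis unfolding finite_subcovers_def by blast
qed

text \<open>Finiteness of \<open>c\<close> lets one divide by it. This is how an estimate for every subcover, or for
  every orbit in a member of one, passes to the infimum.\<close>

lemma le_mult_INF_ennreal:
  fixes x c :: ennreal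
  assumes "\<And>i. i \<in> I \<Longrightarrow> x \<le> c * f i" "I \<noteq> {}" "c < \<infinity>"
  shows "x \<le> c * (INF i\<in>I. f i)"
proof (cases "c = 0")
  case True
  then show ?thesis using assms(1,2) by auto
next
  case False
  have "x / c \<le> (INF i\<in>I. f i)"
    using assms False by (intro INF_greatest divide_le_posI_ennreal) (auto simp: zero_less_iff_neq_zero)
  then have "c * (x / c) \<le> c * (INF i\<in>I. f i)" by (rule mult_left_mono) simp
  moreover have "c * (x / c) = x"
    using False assms(3) ennreal_mult_divide_eq[of c x]
    by (simp add: ennreal_times_divide mult.commute[of c] less_top)
  ultimately show ?thesis by simp
qed

text \<open>The factor \<open>N\<close> counts the letters for the step across the gap, and \<open>exp G\<close> bounds the
  weight at the point where that step starts.\<close>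

lemma N_cover_gap_submultiplicative:
  assumes G: "\<And>x. \<bar>g x\<bar> \<le> G"
    and ne: "\<And>k. finite_subcovers N F k \<U> \<noteq> {}"
  shows "N_cover N F (m + n + 1) g \<U>
    \<le> ennreal (real N * exp G) * N_cover N F m g \<U> * N_cover N F n g \<U>"
proof -
  define S where "S = (\<lambda>k (\<gamma> :: orbit set). SUP X\<in>\<gamma>. ennreal (E_weight k g X))"
  let ?K = "ennreal (real N * exp G)"
  have main: "N_cover N F (m + n + 1) g \<U> \<le> ?K * (\<Sum>\<gamma>\<in>C. S m \<gamma>) * (\<Sum>\<delta>\<in>D. S n \<delta>)"
    if C: "C \<in> finite_subcovers N F m \<U>" and D: "D \<in> finite_subcovers N F n \<U>" for C D
  proof -
    let ?f = "\<lambda>(\<gamma>, t, \<delta>). orbit_splice N F m n \<gamma> t \<delta>"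
    have fin: "finite C" "finite D" using C D by (auto simp: finite_subcovers_def)
    have sup: "S (m + n + 1) (orbit_splice N F m n \<gamma> t \<delta>) \<le> ennreal (exp G) * S m \<gamma> * S n \<delta>" for \<gamma> t \<delta>
      unfolding S_def
    proof (rule SUP_least)
      fix X assume X: "X \<in> orbit_splice N F m n \<gamma> t \<delta>"
      then have "E_weight (m + n + 1) g X = exp (g (Pi_coord m X)) *
          E_weight m g (orbit_take m X) * E_weight n g (orbit_drop (m + 1) X)"
        by (intro E_weight_split) (auto simp: orbit_splice_def)
      then have "ennreal (E_weight (m + n + 1) g X) = ennreal (exp (g (Pi_coord m X))) *
          ennreal (E_weight m g (orbit_take m X)) * ennreal (E_weight n g (orbit_drop (m + 1) X))"
        by (simp add: ennreal_mult E_weight_def)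
      also have "\<dots> \<le> ennreal (exp G) * (SUP X\<in>\<gamma>. ennreal (E_weight m g X)) * (SUP X\<in>\<delta>. ennreal (E_weight n g X))"
        using X G[of "Pi_coord m X"]
        by (intro mult_mono ennreal_leI SUP_upper) (auto simp: orbit_splice_def)
      finally show "ennreal (E_weight (m + n + 1) g X) \<le> \<dots>" .
    qed
    have "N_cover N F (m + n + 1) g \<U> \<le> (\<Sum>\<gamma>\<in>?f ` (C \<times> {1..N} \<times> D). S (m + n + 1) \<gamma>)"
      unfolding N_cover_def S_def by (rule INF_lower[OF splice_subcover[OF C D]])
    also have "\<dots> \<le> (\<Sum>p\<in>C \<times> {1..N} \<times> D. S (m + n + 1) (?f p))"
      using sum_image_le[of "C \<times> {1..N} \<times> D" "S (m + n + 1)" ?f] fin by simp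
    also have "\<dots> \<le> (\<Sum>(\<gamma>, t, \<delta>)\<in>C \<times> {1..N} \<times> D. ennreal (exp G) * S m \<gamma> * S n \<delta>)"
      using sup by (intro sum_mono) auto
    also have "\<dots> = (\<Sum>\<gamma>\<in>C. \<Sum>t\<in>{1..N}. \<Sum>\<delta>\<in>D. ennreal (exp G) * S m \<gamma> * S n \<delta>)"
      by (simp only: sum.cartesian_product)
    also have "\<dots> = (\<Sum>\<gamma>\<in>C. ?K * S m \<gamma> * (\<Sum>\<delta>\<in>D. S n \<delta>))"
    proof (rule sum.cong[OF refl])
      fix \<gamma>
      have "(\<Sum>\<delta>\<in>D. ennreal (exp G) * S m \<gamma> * S n \<delta>) = ennreal (exp G) * S m \<gamma> * (\<Sum>\<delta>\<in>D. S n \<delta>)"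
        by (rule sum_distrib_left[symmetric])
      then show "(\<Sum>t\<in>{1..N}. \<Sum>\<delta>\<in>D. ennreal (exp G) * S m \<gamma> * S n \<delta>)
          = ?K * S m \<gamma> * (\<Sum>\<delta>\<in>D. S n \<delta>)"
        by (simp add: ennreal_mult ennreal_of_nat_eq_real_of_nat mult.assoc)
    qed
    also have "\<dots> = ?K * (\<Sum>\<gamma>\<in>C. S m \<gamma>) * (\<Sum>\<delta>\<in>D. S n \<delta>)"
      by (simp only: sum_distrib_left[symmetric] sum_distrib_right[symmetric])
    finally show ?thesis .
  qed
  have fin: "(\<Sum>\<gamma>\<in>C. S m \<gamma>) < \<infinity>" if "C \<in> finite_subcovers N F m \<U>" for C
    unfolding S_def by (rule sum_SUP_E_weight_finite[OF G]) (use that in \<open>auto simp: finite_subcovers_def\<close>)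
  have step: "N_cover N F (m + n + 1) g \<U> \<le> (?K * N_cover N F n g \<U>) * (\<Sum>\<gamma>\<in>C. S m \<gamma>)"
    if C: "C \<in> finite_subcovers N F m \<U>" for C
  proof -
    have "N_cover N F (m + n + 1) g \<U>
        \<le> (?K * (\<Sum>\<gamma>\<in>C. S m \<gamma>)) * (INF D\<in>finite_subcovers N F n \<U>. \<Sum>\<delta>\<in>D. S n \<delta>)"
    proof (rule le_mult_INF_ennreal)
      show "?K * (\<Sum>\<gamma>\<in>C. S m \<gamma>) < \<infinity>"
        using fin[OF C] by (simp add: ennreal_mult_less_top)
    qed (rule main[OF C], assumption, rule ne)
    then show ?thesis by (simp add: N_cover_def S_def mult_ac)
  qed
  have "N_cover N F (m + n + 1) g \<U>
      \<le> (?K * N_cover N F n g \<U>) * (INF C\<in>finite_subcovers N F m \<U>. \<Sum>\<gamma>\<in>C. S m \<gamma>)"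
  proof (rule le_mult_INF_ennreal)
    show "?K * N_cover N F n g \<U> < \<infinity>"
      using N_cover_finite[OF G ne] by (simp add: ennreal_mult_less_top)
  qed (rule step, assumption, rule ne)
  then show ?thesis by (simp add: N_cover_def S_def mult_ac)
qed

section \<open>Comparison with separated sets\<close>

text \<open>Two orbits in the same member of the orbit cover cannot belong to the same separated set
  when the cover is fine.\<close>

lemma orbit_cover_member_close:
  assumes "\<gamma> \<in> orbit_cover N F k \<U>" "X \<in> \<gamma>" "Y \<in> \<gamma>"
  shows "i \<le> k \<Longrightarrow> dist (Pi_coord i X) (Pi_coord i Y) \<le> cover_diam \<U>"
    and "i \<in> {1..k} \<Longrightarrow> proj_coord i X = proj_coord i Y"
proof -
  obtain U j where \<gamma>: "\<gamma> = cylinder N F k U j" and U: "\<forall>i\<le>k. U i \<in> \<U>"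
    using assms(1) unfolding orbit_cover_eq_cylinders by blast
  show "dist (Pi_coord i X) (Pi_coord i Y) \<le> cover_diam \<U>" if "i \<le> k"
    using that assms(2,3) U by (intro dist_le_cover_diam[of "U i"]) (auto simp: \<gamma> cylinder_def)
  show "proj_coord i X = proj_coord i Y" if "i \<in> {1..k}"
    using that assms(2,3) by (simp add: \<gamma> cylinder_def)
qed

text \<open>Choose for each orbit of \<open>Y\<close> a member of \<open>C\<close> that contains it. Two orbits with the same
  choice would have the same word and stay within the diameter of the cover, hence within \<open>\<epsilon>\<close>.\<close>

lemma separated_injects_into_subcover:
  assumes Y: "separated N F k \<epsilon> Y" and C: "C \<in> finite_subcovers N F k \<U>"
    and d: "cover_diam \<U> \<le> \<epsilon>"
  obtains c where "c ` Y \<subseteq> C" "inj_on c Y" "\<And>X. X \<in> Y \<Longrightarrow> X \<in> c X"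
proof -
  have "\<forall>X\<in>Y. \<exists>\<gamma>. \<gamma> \<in> C \<and> X \<in> \<gamma>"
  proof
    fix X assume "X \<in> Y"
    then have "X \<in> \<Union>C" using Y C by (auto simp: separated_def finite_subcovers_def)
    then show "\<exists>\<gamma>. \<gamma> \<in> C \<and> X \<in> \<gamma>" by blast
  qed
  then obtain c where c: "c X \<in> C" "X \<in> c X" if "X \<in> Y" for X by metis
  have "inj_on c Y"
  proof (rule inj_onI, rule ccontr)
    fix X X' assume X: "X \<in> Y" "X' \<in> Y" "c X = c X'" "X \<noteq> X'"
    have \<gamma>: "c X \<in> orbit_cover N F k \<U>" "X \<in> c X" "X' \<in> c X"
      using c(1)[OF X(1)] c(2)[OF X(1)] c(2)[OF X(2)] X(3) C
      by (simp_all add: finite_subcovers_def subset_iff)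
    have "(\<exists>i\<le>k. dist (Pi_coord i X) (Pi_coord i X') > \<epsilon>) \<or>
        (\<exists>i\<in>{1..k}. proj_coord i X \<noteq> proj_coord i X')"
      using Y X by (auto simp: separated_def)
    then show False
      using orbit_cover_member_close[OF \<gamma>] d by fastforce
  qed
  moreover have "c ` Y \<subseteq> C" using c by auto
  ultimately show ?thesis using c that by blast
qed

text \<open>All separated sets inject into one finite subcover, obtained from a sufficiently fine cover
  of the sphere. Consequently one of maximal cardinality exists.\<close>

lemma separated_finite_card_bounded:
  assumes "\<epsilon> > 0"
  shows "\<exists>n. \<forall>Y. separated N F k \<epsilon> Y \<longrightarrow> finite Y \<and> card Y \<le> n"
proof -
  obtain \<U> where \<U>: "open_cover \<U>" "cover_diam \<U> < \<epsilon>" using small_cover_exists[OF assms] by blast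
  then obtain C where C: "C \<in> finite_subcovers N F k \<U>"
    using finite_subcover_exists by blast
  then have fin: "finite C" by (simp add: finite_subcovers_def)
  have "finite Y \<and> card Y \<le> card C" if Y: "separated N F k \<epsilon> Y" for Y
  proof -
    obtain c where "c ` Y \<subseteq> C" "inj_on c Y"
      by (rule separated_injects_into_subcover[OF Y C less_imp_le[OF \<U>(2)]])
    then show ?thesis using fin by (meson card_inj_on_le inj_on_finite)
  qed
  then show ?thesis by blast
qed

lemma separated_sum_le_N_cover:
  assumes \<epsilon>: "\<epsilon> > 0" and d: "cover_diam \<U> \<le> \<epsilon>"
  shows "separated_sum N F k g \<epsilon> \<le> N_cover N F k g \<U>"
  unfolding separated_sum_def N_cover_def
proof (intro SUP_least INF_greatest)
  fix Y C assume "Y \<in> {Y. separated N F k \<epsilon> Y}" and C: "C \<in> finite_subcovers N F k \<U>"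
  then have Y: "separated N F k \<epsilon> Y" by simp
  obtain c where c: "c ` Y \<subseteq> C" "inj_on c Y" "\<And>X. X \<in> Y \<Longrightarrow> X \<in> c X"
    using separated_injects_into_subcover[OF Y C d] by blast
  have "finite Y" using separated_finite_card_bounded[OF \<epsilon>] Y by blast
  then have "(\<Sum>\<^sub>\<infinity>X\<in>Y. ennreal (E_weight k g X)) = (\<Sum>X\<in>Y. ennreal (E_weight k g X))" by simp
  also have "\<dots> \<le> (\<Sum>X\<in>Y. SUP Z\<in>c X. ennreal (E_weight k g Z))"
    by (intro sum_mono SUP_upper c(3))
  also have "\<dots> = (\<Sum>\<gamma>\<in>c ` Y. SUP Z\<in>\<gamma>. ennreal (E_weight k g Z))"
    using c(2) by (simp add: sum.reindex)
  also have "\<dots> \<le> (\<Sum>\<gamma>\<in>C. SUP Z\<in>\<gamma>. ennreal (E_weight k g Z))"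
    using C c(1) by (intro sum_mono2) (auto simp: finite_subcovers_def)
  finally show "(\<Sum>\<^sub>\<infinity>X\<in>Y. ennreal (E_weight k g X)) \<le> (\<Sum>\<gamma>\<in>C. SUP Z\<in>\<gamma>. ennreal (E_weight k g Z))" .
qed

text \<open>An orbit that is not shadowed by a separated set can be added to it, which is impossible if
  the cardinality was maximal.\<close>

lemma maximal_separated_spans:
  assumes "\<epsilon> > 0"
  obtains Y where "separated N F k \<epsilon> Y" "finite Y"
    "\<And>X. X \<in> orbits N F k \<Longrightarrow> \<exists>Z\<in>Y. (\<forall>i\<le>k. dist (Pi_coord i Z) (Pi_coord i X) \<le> \<epsilon>) \<and>
        (\<forall>i\<in>{1..k}. proj_coord i X = proj_coord i Z)"
proof -
  obtain n where n: "\<And>Y. separated N F k \<epsilon> Y \<Longrightarrow> finite Y \<and> card Y \<le> n"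
    using separated_finite_card_bounded[OF assms] by blast
  have "separated N F k \<epsilon> {}" by (simp add: separated_def)
  moreover have "\<forall>Y. separated N F k \<epsilon> Y \<longrightarrow> card Y < Suc n" using n by (auto simp: less_Suc_eq_le)
  ultimately obtain Y where Y: "separated N F k \<epsilon> Y"
    and max: "\<And>Z. separated N F k \<epsilon> Z \<Longrightarrow> card Z \<le> card Y"
    using ex_has_greatest_nat[of "separated N F k \<epsilon>" "{}" card "Suc n"] by blast
  have "\<exists>Z\<in>Y. (\<forall>i\<le>k. dist (Pi_coord i Z) (Pi_coord i X) \<le> \<epsilon>) \<and>
        (\<forall>i\<in>{1..k}. proj_coord i X = proj_coord i Z)" if X: "X \<in> orbits N F k" for X
  proof (rule ccontr)
    assume far: "\<not> ?thesis"
    then have "X \<notin> Y" using assms by force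
    have far': "(\<exists>i\<le>k. dist (Pi_coord i Z) (Pi_coord i X) > \<epsilon>) \<or>
        (\<exists>i\<in>{1..k}. proj_coord i X \<noteq> proj_coord i Z)" if "Z \<in> Y" for Z
      using far that by (meson not_le)
    have "separated N F k \<epsilon> (insert X Y)"
      unfolding separated_def
    proof (intro conjI ballI impI)
      show "insert X Y \<subseteq> orbits N F k" using X Y by (simp add: separated_def)
      fix Z W assume "Z \<in> insert X Y" "W \<in> insert X Y" "Z \<noteq> W"
      then consider "Z = X" "W \<in> Y" | "W = X" "Z \<in> Y" | "Z \<in> Y" "W \<in> Y" by blast
      then show "(\<exists>i\<le>k. dist (Pi_coord i Z) (Pi_coord i W) > \<epsilon>) \<or>
          (\<exists>i\<in>{1..k}. proj_coord i Z \<noteq> proj_coord i W)"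
      proof cases
        case 1
        then show ?thesis using far'[of W] by (simp add: dist_commute)
      next
        case 2
        then show ?thesis using far'[of Z] by metis
      next
        case 3
        then show ?thesis using Y \<open>Z \<noteq> W\<close> by (simp add: separated_def)
      qed
    qed
    then have "card (insert X Y) \<le> card Y" by (rule max)
    then show False using \<open>X \<notin> Y\<close> n[OF Y] by simp
  qed
  then show ?thesis using that Y n by blast
qed

text \<open>Each orbit \<open>Z\<close> of a maximal separated set yields the cylinder over sets of \<open>\<U>\<close> that contain
  the closed \<open>\<epsilon>\<close>-balls about its points. These cylinders cover since \<open>Y\<close> spans, and the infimum of
  the weight over the cylinder of \<open>Z\<close> is at most the weight of \<open>Z\<close>, which lies in it.\<close>

lemma M_cover_le_separated_sum:
  assumes \<epsilon>: "\<epsilon> > 0" and leb: "\<And>x. \<exists>U\<in>\<U>. cball x \<epsilon> \<subseteq> U"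
  shows "M_cover N F k g \<U> \<le> separated_sum N F k g \<epsilon>"
proof -
  obtain u where u: "u x \<in> \<U>" "cball x \<epsilon> \<subseteq> u x" for x using leb by metis
  obtain Y where Y: "separated N F k \<epsilon> Y" "finite Y"
    and span: "\<And>X. X \<in> orbits N F k \<Longrightarrow> \<exists>Z\<in>Y. (\<forall>i\<le>k. dist (Pi_coord i Z) (Pi_coord i X) \<le> \<epsilon>) \<and>
        (\<forall>i\<in>{1..k}. proj_coord i X = proj_coord i Z)"
    using maximal_separated_spans[OF \<epsilon>] by blast
  have orb: "Y \<subseteq> orbits N F k" using Y by (simp add: separated_def)
  define c where "c = (\<lambda>X. cylinder N F k (\<lambda>i. u (Pi_coord i X)) (\<lambda>i. proj_coord i X))"
  have near: "X \<in> c Z" if "X \<in> orbits N F k" "\<forall>i\<le>k. dist (Pi_coord i Z) (Pi_coord i X) \<le> \<epsilon>"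
    "\<forall>i\<in>{1..k}. proj_coord i X = proj_coord i Z" for X Z
    using that u(2) unfolding c_def cylinder_def by (auto simp: subset_iff)
  have "c ` Y \<in> finite_subcovers N F k \<U>"
    unfolding finite_subcovers_def
  proof (intro CollectI conjI equalityI subsetI)
    show "finite (c ` Y)" using Y by simp
    show "\<gamma> \<in> orbit_cover N F k \<U>" if \<gamma>: "\<gamma> \<in> c ` Y" for \<gamma>
    proof -
      obtain Z where "Z \<in> Y" "\<gamma> = c Z" using \<gamma> by blast
      then show ?thesis
        using orb unfolding c_def by (auto intro!: cylinder_in_orbit_cover u(1) orbits_proj_coord simp del: atLeastAtMost_iff)
    qed
    show "X \<in> orbits N F k" if "X \<in> \<Union>(c ` Y)" for X
      using that by (auto simp: c_def cylinder_def)
    show "X \<in> \<Union>(c ` Y)" if X: "X \<in> orbits N F k" for X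
      using span[OF X] near[OF X] by blast
  qed
  then have "M_cover N F k g \<U> \<le> (\<Sum>\<gamma>\<in>c ` Y. INF X\<in>\<gamma>. ennreal (E_weight k g X))"
    unfolding M_cover_def by (rule INF_lower)
  also have "\<dots> \<le> (\<Sum>Z\<in>Y. INF X\<in>c Z. ennreal (E_weight k g X))"
    using sum_image_le[OF Y(2), of "\<lambda>\<gamma>. INF X\<in>\<gamma>. ennreal (E_weight k g X)" c] by (simp add: o_def)
  also have "\<dots> \<le> (\<Sum>Z\<in>Y. ennreal (E_weight k g Z))"
    using orb \<epsilon> by (intro sum_mono INF_lower near) auto
  also have "\<dots> = (\<Sum>\<^sub>\<infinity>Z\<in>Y. ennreal (E_weight k g Z))" using Y by simp
  also have "\<dots> \<le> separated_sum N F k g \<epsilon>"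
    unfolding separated_sum_def using Y by (intro SUP_upper) simp
  finally show ?thesis .
qed

section \<open>Comparison of the two cover sums\<close>

lemma E_weight_oscillation:
  assumes "\<And>i. i < k \<Longrightarrow> \<bar>g (Pi_coord i X) - g (Pi_coord i Y)\<bar> \<le> \<tau>"
  shows "E_weight k g X \<le> exp (\<tau> * real k) * E_weight k g Y"
proof -
  have "(\<Sum>i<k. g (Pi_coord i X)) \<le> (\<Sum>i<k. \<tau> + g (Pi_coord i Y))"
  proof (rule sum_mono)
    fix i assume "i \<in> {..<k}"
    then show "g (Pi_coord i X) \<le> \<tau> + g (Pi_coord i Y)" using assms[of i] by simp
  qed
  then have "(\<Sum>i<k. g (Pi_coord i X)) \<le> \<tau> * real k + (\<Sum>i<k. g (Pi_coord i Y))"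
    by (simp add: sum.distrib mult.commute)
  then show ?thesis unfolding E_weight_def exp_add[symmetric] by simp
qed

text \<open>The estimate holds for each subcover separately: within one of its members, the Birkhoff
  sums of \<open>g\<close> along two orbits differ by at most \<open>\<tau>\<close> for each index below \<open>k\<close>.\<close>

lemma N_cover_le_M_cover:
  assumes osc: "\<And>x y. dist x y \<le> cover_diam \<U> \<Longrightarrow> \<bar>g x - g y\<bar> \<le> \<tau>"
    and ne: "finite_subcovers N F k \<U> \<noteq> {}"
  shows "N_cover N F k g \<U> \<le> ennreal (exp (\<tau> * real k)) * M_cover N F k g \<U>"
  unfolding M_cover_def
proof (rule le_mult_INF_ennreal[OF _ ne])
  fix C assume C: "C \<in> finite_subcovers N F k \<U>"
  let ?K = "ennreal (exp (\<tau> * real k))"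
  have "N_cover N F k g \<U> \<le> (\<Sum>\<gamma>\<in>C. SUP X\<in>\<gamma>. ennreal (E_weight k g X))"
    unfolding N_cover_def using C by (rule INF_lower)
  also have "\<dots> \<le> (\<Sum>\<gamma>\<in>C. ?K * (INF X\<in>\<gamma>. ennreal (E_weight k g X)))"
  proof (intro sum_mono SUP_least)
    fix \<gamma> X assume "\<gamma> \<in> C" and X: "X \<in> \<gamma>"
    then have \<gamma>: "\<gamma> \<in> orbit_cover N F k \<U>" using C by (auto simp: finite_subcovers_def)
    show "ennreal (E_weight k g X) \<le> ?K * (INF X\<in>\<gamma>. ennreal (E_weight k g X))"
    proof (rule le_mult_INF_ennreal)
      fix Y assume "Y \<in> \<gamma>"
      then have "E_weight k g X \<le> exp (\<tau> * real k) * E_weight k g Y"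
        using orbit_cover_member_close(1)[OF \<gamma> X] by (intro E_weight_oscillation osc) auto
      then show "ennreal (E_weight k g X) \<le> ?K * ennreal (E_weight k g Y)"
        by (simp add: ennreal_leI flip: ennreal_mult')
    qed (use X in auto)
  qed
  also have "\<dots> = ?K * (\<Sum>\<gamma>\<in>C. INF X\<in>\<gamma>. ennreal (E_weight k g X))"
    by (rule sum_distrib_left[symmetric])
  finally show "N_cover N F k g \<U> \<le> \<dots>" .
qed simp

section \<open>Exponential growth rates\<close>

abbreviation rate :: "(nat \<Rightarrow> ennreal) \<Rightarrow> nat \<Rightarrow> ereal" where
  "rate f k \<equiv> ereal (1 / real k) * ennreal_ln (f k)"

lemma rate_mono: "f k \<le> h k \<Longrightarrow> rate f k \<le> rate h k"
  by (intro ereal_mult_left_mono ennreal_ln_mono) auto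

lemma ennreal_ln_ennreal: "x > 0 \<Longrightarrow> ennreal_ln (ennreal x) = ereal (ln x)"
  by (simp add: ennreal_ln_def)

text \<open>The identity includes the degenerate values \<open>0\<close> and \<open>\<infinity>\<close> of \<open>f k\<close>, where both sides are
  infinite of the same sign.\<close>

lemma rate_exp_mult:
  assumes "k > 0"
  shows "rate (\<lambda>k. ennreal (exp (\<tau> * real k)) * f k) k = ereal \<tau> + rate f k"
proof (cases "f k")
  case (real r)
  show ?thesis
  proof (cases "r = 0")
    case True
    then show ?thesis using assms real by (simp add: ennreal_ln_def)
  next
    case False
    then have r: "r > 0" using real by simp
    have "ennreal (exp (\<tau> * real k)) * f k = ennreal (exp (\<tau> * real k) * r)"
      using r by (simp add: real ennreal_mult)
    then show ?thesis
      using r assms by (simp add: real(2) ennreal_ln_ennreal ln_mult field_simps)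
  qed
next
  case top
  then show ?thesis using assms by (simp add: ennreal_ln_def ennreal_mult_eq_top_iff ennreal_mult_top)
qed

lemma N_cover_rate_convergent:
  assumes hc: "holomorphic_correspondence N F" and g: "continuous_on UNIV g" and \<U>: "open_cover \<U>"
  shows "convergent (rate (\<lambda>k. N_cover N F k g \<U>))"
proof -
  obtain G where G: "\<And>x. \<bar>g x\<bar> \<le> G" using continuous_bounded[OF g] by blast
  have N: "1 \<le> N" using hc by (simp add: holomorphic_correspondence_def)
  have ne: "finite_subcovers N F k \<U> \<noteq> {}" for k
    by (rule finite_subcover_exists[OF \<U>])
  define b where "b = (\<lambda>k. enn2real (N_cover N F k g \<U>))"
  have b: "N_cover N F k g \<U> = ennreal (b k)" for k
    using N_cover_finite[OF G ne, of k] by (simp add: b_def)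
  have low: "exp (- (G * real k)) \<le> b k" for k
  proof -
    have "ennreal (exp (- (G * real k))) \<le> ennreal (b k)"
      using N_cover_lower[of g, OF G orbits_nonempty[OF hc]] unfolding b[symmetric] .
    then show ?thesis by (subst (asm) ennreal_le_iff) (auto simp: b_def)
  qed
  have pos: "b k > 0" for k using less_le_trans[OF exp_gt_zero low] .
  have "convergent (\<lambda>k. ln (b k) / real k)"
  proof (rule gap_subadditive_convergent)
    fix m n
    have "ennreal (b (m + n + 1)) \<le> ennreal (real N * exp G * b m * b n)"
      using N_cover_gap_submultiplicative[of g, OF G ne, of m n] unfolding b
      using pos by (simp add: less_imp_le flip: ennreal_mult)
    then have "b (m + n + 1) \<le> real N * exp G * b m * b n"
      using pos[of m] pos[of n] by (subst (asm) ennreal_le_iff) (auto intro!: mult_nonneg_nonneg)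
    then have "ln (b (m + n + 1)) \<le> ln (real N * exp G * b m * b n)"
      using pos by (subst ln_le_cancel_iff) (use N in \<open>auto intro!: mult_pos_pos\<close>)
    also have "\<dots> = ln (b m) + ln (b n) + ln (real N * exp G)"
      using pos[of m] pos[of n] N by (simp add: ln_mult)
    finally show "ln (b (m + n + 1)) \<le> ln (b m) + ln (b n) + ln (real N * exp G)" .
  next
    fix n
    show "- (G * real n) \<le> ln (b n)" using low[of n] pos[of n] by (simp add: ln_ge_iff)
  qed
  then obtain L where "(\<lambda>k. ln (b k) / real k) \<longlonglongrightarrow> L" by (auto simp: convergent_def)
  then have "(\<lambda>k. ereal (ln (b k) / real k)) \<longlonglongrightarrow> ereal L" by simp
  then have "rate (\<lambda>k. N_cover N F k g \<U>) \<longlonglongrightarrow> ereal L"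
    using pos by (simp add: b ennreal_ln_ennreal)
  then show ?thesis by (auto simp: convergent_def)
qed

text \<open>The growth rate of the separated sums increases as the scale decreases, so each value is
  bounded by the limit.\<close>

lemma limsup_separated_le_pressure:
  assumes "\<epsilon> > 0"
  shows "limsup (rate (\<lambda>k. separated_sum N F k g \<epsilon>)) \<le> pressure N F g"
proof (rule tendsto_lowerbound[OF pressure_tendsto])
  show "\<forall>\<^sub>F \<epsilon>' in at_right 0. limsup (rate (\<lambda>k. separated_sum N F k g \<epsilon>))
      \<le> limsup (rate (\<lambda>k. separated_sum N F k g \<epsilon>'))"
    unfolding eventually_at_right_field
  proof (intro exI[of _ \<epsilon>] conjI allI impI assms)
    fix \<epsilon>' assume "\<epsilon>' < \<epsilon>"
    then show "limsup (rate (\<lambda>k. separated_sum N F k g \<epsilon>)) \<le> limsup (rate (\<lambda>k. separated_sum N F k g \<epsilon>'))"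
      by (intro Limsup_mono always_eventually allI rate_mono separated_sum_antimono) simp
  qed
qed simp

lemma limsup_M_cover_le_pressure:
  assumes "open_cover \<U>"
  shows "limsup (rate (\<lambda>k. M_cover N F k g \<U>)) \<le> pressure N F g"
proof -
  obtain \<epsilon> where \<epsilon>: "\<epsilon> > 0" "\<forall>x. \<exists>U\<in>\<U>. cball x \<epsilon> \<subseteq> U"
    using open_cover_Lebesgue_number[OF assms] by blast
  have "limsup (rate (\<lambda>k. M_cover N F k g \<U>)) \<le> limsup (rate (\<lambda>k. separated_sum N F k g \<epsilon>))"
    using \<epsilon> by (intro Limsup_mono always_eventually allI rate_mono M_cover_le_separated_sum) auto
  also have "\<dots> \<le> pressure N F g" by (rule limsup_separated_le_pressure[OF \<epsilon>(1)])
  finally show ?thesis .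
qed

lemma lim_N_cover_le_liminf_M_cover:
  assumes conv: "convergent (rate (\<lambda>k. N_cover N F k g \<U>))" and \<U>: "open_cover \<U>"
    and osc: "\<And>x y. dist x y \<le> cover_diam \<U> \<Longrightarrow> \<bar>g x - g y\<bar> \<le> \<tau>"
  shows "lim (rate (\<lambda>k. N_cover N F k g \<U>)) \<le> ereal \<tau> + liminf (rate (\<lambda>k. M_cover N F k g \<U>))"
proof -
  have ne: "finite_subcovers N F k \<U> \<noteq> {}" for k
    by (rule finite_subcover_exists[OF \<U>])
  have "lim (rate (\<lambda>k. N_cover N F k g \<U>)) = liminf (rate (\<lambda>k. N_cover N F k g \<U>))"
    using conv by (simp add: convergent_LIMSEQ_iff lim_imp_Liminf)
  also have "\<dots> \<le> liminf (\<lambda>k. ereal \<tau> + rate (\<lambda>k. M_cover N F k g \<U>) k)"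
  proof (intro Liminf_mono eventually_sequentiallyI[of 1])
    fix k :: nat assume "1 \<le> k"
    then have k: "k > 0" by simp
    have "rate (\<lambda>k. N_cover N F k g \<U>) k
        \<le> rate (\<lambda>k. ennreal (exp (\<tau> * real k)) * M_cover N F k g \<U>) k"
      by (rule rate_mono) (rule N_cover_le_M_cover[OF osc ne])
    also have "\<dots> = ereal \<tau> + rate (\<lambda>k. M_cover N F k g \<U>) k" by (rule rate_exp_mult[OF k])
    finally show "rate (\<lambda>k. N_cover N F k g \<U>) k \<le> ereal \<tau> + rate (\<lambda>k. M_cover N F k g \<U>) k" .
  qed
  also have "\<dots> = ereal \<tau> + liminf (rate (\<lambda>k. M_cover N F k g \<U>))"
    by (rule Liminf_add_ereal_left) auto
  finally show ?thesis .
qed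

section \<open>The limits as the covers are refined\<close>

text \<open>The slack is real while \<open>a\<close> and \<open>b\<close> may be infinite, so that the squeezing argument below
  also covers an infinite limit.\<close>

lemma ereal_less_add_small:
  fixes a b :: ereal
  assumes "a < b"
  shows "\<exists>e>0. ereal e + a < b"
proof -
  consider "a = - \<infinity>" | x where "a = ereal x" "b = \<infinity>" | x y where "a = ereal x" "b = ereal y"
    using assms by (cases a; cases b) auto
  then show ?thesis
  proof cases
    case 1
    then show ?thesis using assms by (intro exI[of _ 1]) simp
  next
    case (2 x)
    then show ?thesis by (intro exI[of _ 1]) simp
  next
    case (3 x y)
    then show ?thesis using assms by (intro exI[of _ "(y - x) / 2"]) (simp add: field_simps)
  qed
qed

text \<open>A squeezing principle in which both bounds hold up to an arbitrarily small error: the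
  comparison of the two cover sums leaves such an error, coming from the oscillation of \<open>g\<close>.\<close>

lemma ereal_tendsto_sandwich_slack:
  fixes l h :: "'a \<Rightarrow> ereal"
  assumes l: "(l \<longlongrightarrow> P) A"
    and lower: "\<And>e. e > 0 \<Longrightarrow> \<forall>\<^sub>F x in A. l x \<le> ereal e + h x"
    and upper: "\<And>e. e > 0 \<Longrightarrow> \<forall>\<^sub>F x in A. h x \<le> ereal e + P"
  shows "(h \<longlongrightarrow> P) A"
proof (rule order_tendstoI)
  fix a assume "a < P"
  then obtain e where e: "e > 0" "ereal e + a < P" using ereal_less_add_small by blast
  from order_tendstoD(1)[OF l e(2)] lower[OF e(1)] show "\<forall>\<^sub>F x in A. a < h x"
  proof eventually_elim
    case (elim x)
    then have "ereal e + a < ereal e + h x" by simp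
    then show ?case by (meson add_left_mono not_le)
  qed
next
  fix b assume "P < b"
  then obtain e where e: "e > 0" "ereal e + P < b" using ereal_less_add_small by blast
  show "\<forall>\<^sub>F x in A. h x < b" using upper[OF e(1)] by eventually_elim (use e(2) in simp)
qed

theorem theorem3p4:
  fixes N :: nat
    and F :: "nat \<Rightarrow> (riemann_sphere \<times> riemann_sphere) set"
    and g :: "riemann_sphere \<Rightarrow> real"
  assumes "holomorphic_correspondence N F"
    and "continuous_on UNIV g"
  shows "(\<forall>\<U>. open_cover \<U> \<longrightarrow>
            convergent (\<lambda>k. ereal (1 / real k) * ennreal_ln (N_cover N F k g \<U>))) \<and>
         ((\<lambda>\<delta>. SUP \<U>\<in>{\<U>. open_cover \<U> \<and> cover_diam \<U> < \<delta>}.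
              lim (\<lambda>k. ereal (1 / real k) * ennreal_ln (N_cover N F k g \<U>)))
            \<longlongrightarrow> pressure N F g) (at_right 0) \<and>
         ((\<lambda>\<delta>. SUP \<U>\<in>{\<U>. open_cover \<U> \<and> cover_diam \<U> < \<delta>}.
              liminf (\<lambda>k. ereal (1 / real k) * ennreal_ln (M_cover N F k g \<U>)))
            \<longlongrightarrow> pressure N F g) (at_right 0) \<and>
         ((\<lambda>\<delta>. SUP \<U>\<in>{\<U>. open_cover \<U> \<and> cover_diam \<U> < \<delta>}.
              limsup (\<lambda>k. ereal (1 / real k) * ennreal_ln (M_cover N F k g \<U>)))
            \<longlongrightarrow> pressure N F g) (at_right 0)"
proof -
  define P where "P = pressure N F g"
  define small where "small = (\<lambda>\<delta>. {\<U>. open_cover \<U> \<and> cover_diam \<U> < \<delta>})"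
  define s where "s = (\<lambda>\<delta>. limsup (rate (\<lambda>k. separated_sum N F k g \<delta>)))"
  define n where "n = (\<lambda>\<U>. lim (rate (\<lambda>k. N_cover N F k g \<U>)))"
  define mi where "mi = (\<lambda>\<U>. liminf (rate (\<lambda>k. M_cover N F k g \<U>)))"
  define ms where "ms = (\<lambda>\<U>. limsup (rate (\<lambda>k. M_cover N F k g \<U>)))"
  have conv: "convergent (rate (\<lambda>k. N_cover N F k g \<U>))" if "open_cover \<U>" for \<U>
    by (rule N_cover_rate_convergent[OF assms that])
  have s: "(s \<longlongrightarrow> P) (at_right 0)" unfolding s_def P_def by (rule pressure_tendsto)
  have s_n: "s \<delta> \<le> (SUP \<U>\<in>small \<delta>. n \<U>)" if \<delta>: "\<delta> > 0" for \<delta>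
  proof -
    obtain \<U> where \<U>: "open_cover \<U>" "cover_diam \<U> < \<delta>" using small_cover_exists[OF \<delta>] by blast
    have "s \<delta> \<le> limsup (rate (\<lambda>k. N_cover N F k g \<U>))"
      unfolding s_def using \<U> \<delta>
      by (intro Limsup_mono always_eventually allI rate_mono separated_sum_le_N_cover) auto
    also have "\<dots> = n \<U>"
      unfolding n_def using conv[OF \<U>(1)] by (simp add: convergent_LIMSEQ_iff lim_imp_Limsup)
    also have "\<dots> \<le> (SUP \<U>\<in>small \<delta>. n \<U>)" using \<U> by (intro SUP_upper) (simp add: small_def)
    finally show ?thesis .
  qed
  \<comment> \<open>Uniform continuity: the oscillation of \<open>g\<close> on a cover of diameter below \<open>d\<close> is at most \<open>e\<close>.\<close>
  have n_mi: "\<forall>\<^sub>F \<delta> in at_right 0. \<forall>\<U>\<in>small \<delta>. n \<U> \<le> ereal e + mi \<U>" if e: "e > 0" for e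
  proof -
    obtain d where d: "d > 0" "\<forall>x y. dist x y < d \<longrightarrow> \<bar>g x - g y\<bar> < e"
      using continuous_oscillation[OF assms(2) e] by blast
    have "n \<U> \<le> ereal e + mi \<U>" if "\<delta> < d" "\<U> \<in> small \<delta>" for \<delta> \<U>
      unfolding n_def mi_def using that d(2)
      by (intro lim_N_cover_le_liminf_M_cover conv) (auto simp: small_def intro!: less_imp_le)
    then show ?thesis unfolding eventually_at_right_field using d(1) by blast
  qed
  have mi_ms: "mi \<U> \<le> ms \<U>" for \<U> unfolding mi_def ms_def by (simp add: Liminf_le_Limsup)
  have ms_P: "ms \<U> \<le> P" if "\<U> \<in> small \<delta>" for \<U> \<delta>
    unfolding ms_def P_def using that by (intro limsup_M_cover_le_pressure) (simp add: small_def)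
  have pos: "\<forall>\<^sub>F \<delta> in at_right (0::real). \<delta> > 0"
    by (simp add: eventually_at_right_less)
  have slack: "x \<le> ereal e + x" if "e > 0" for e and x :: ereal
    using that add_right_mono[of 0 "ereal e" x] by simp
  have lim_n: "((\<lambda>\<delta>. SUP \<U>\<in>small \<delta>. n \<U>) \<longlongrightarrow> P) (at_right 0)"
  proof (rule ereal_tendsto_sandwich_slack[OF s])
    fix e :: real assume e: "e > 0"
    show "\<forall>\<^sub>F \<delta> in at_right 0. s \<delta> \<le> ereal e + (SUP \<U>\<in>small \<delta>. n \<U>)"
      using pos by eventually_elim (meson s_n slack[OF e] order_trans)
    show "\<forall>\<^sub>F \<delta> in at_right 0. (SUP \<U>\<in>small \<delta>. n \<U>) \<le> ereal e + P"
      using n_mi[OF e]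
      by eventually_elim (intro SUP_least, meson add_left_mono mi_ms ms_P order_trans)
  qed
  \<comment> \<open>The lower and the upper growth rate of \<^const>\<open>M_cover\<close> are treated at once: only the position
    of \<open>m\<close> between \<open>mi\<close> and the pressure matters.\<close>
  have lim_m: "((\<lambda>\<delta>. SUP \<U>\<in>small \<delta>. m \<U>) \<longlongrightarrow> P) (at_right 0)"
    if m: "\<And>\<U>. mi \<U> \<le> m \<U>" "\<And>\<U> \<delta>. \<U> \<in> small \<delta> \<Longrightarrow> m \<U> \<le> P" for m
  proof (rule ereal_tendsto_sandwich_slack[OF s])
    fix e :: real assume e: "e > 0"
    show "\<forall>\<^sub>F \<delta> in at_right 0. s \<delta> \<le> ereal e + (SUP \<U>\<in>small \<delta>. m \<U>)"
      using pos n_mi[OF e]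
    proof eventually_elim
      case (elim \<delta>)
      have "n \<U> \<le> ereal e + (SUP \<U>\<in>small \<delta>. m \<U>)" if "\<U> \<in> small \<delta>" for \<U>
      proof -
        have "n \<U> \<le> ereal e + mi \<U>" using elim(2) that by blast
        also have "\<dots> \<le> ereal e + (SUP \<U>\<in>small \<delta>. m \<U>)"
          using m(1) that by (intro add_left_mono SUP_upper2[of \<U>]) auto
        finally show ?thesis .
      qed
      then have "(SUP \<U>\<in>small \<delta>. n \<U>) \<le> ereal e + (SUP \<U>\<in>small \<delta>. m \<U>)" by (rule SUP_least)
      then show ?case using s_n[OF elim(1)] by (rule order_trans[rotated])
    qed
    show "\<forall>\<^sub>F \<delta> in at_right 0. (SUP \<U>\<in>small \<delta>. m \<U>) \<le> ereal e + P"
      using m(2) slack[OF e, of P] by (intro always_eventually allI SUP_least) (meson order_trans)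
  qed
  have "((\<lambda>\<delta>. SUP \<U>\<in>small \<delta>. mi \<U>) \<longlongrightarrow> P) (at_right 0)"
    by (rule lim_m) (use mi_ms ms_P order_trans in \<open>blast+\<close>)
  moreover have "((\<lambda>\<delta>. SUP \<U>\<in>small \<delta>. ms \<U>) \<longlongrightarrow> P) (at_right 0)"
    by (rule lim_m[OF mi_ms ms_P])
  ultimately show ?thesis
    using conv lim_n unfolding small_def n_def mi_def ms_def P_def by blast
qed

end
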